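(* Let $n\ge 1$ be an integer and let $T$ be a tree. Then the $n$-cube visibility number of $T$ equals its $n$-cube arboricity, and the $n$-cube orthogonal visibility number of $T$ equals its $n$-cube orthogonal arboricity; that is, $$\Upsilon_{h^{(n)}}(T)=h^{(n)}(T)\qquad\text{and}\qquad \Upsilon_{h^{(n)\perp}}(T)=h^{(n)\perp}(T).$$
   Context: All graphs are finite and simple. An $n$-cube is an $n$-dimensional (closed) unit hypercube; $\mathbf e_1,\dots,\mathbf e_n$ denote standard basis vectors. Standard model: the objects are pairwise disjoint axis-aligned unit $n$-cubes in $\mathbb{R}^n$. Two cubes see each other if there is an uninterrupted axis-aligned cylindrical channel of positive diameter (a cylinder parallel to some $\mathbf e_i$, $i\in\{1,\dots,n\}$) joining them, where uninterrupted means that it intersects none of the other cubes of the representation. Orthogonal model: the objects are pairwise disjoint unit $n$-cubes in $\mathbb{R}^{n+1}$ aligned with the first $n$ axes, i.e. sets of the form $\prod_{i=1}^n[a_i,a_i+1]\times\{c\}$. Two cubes see each other if there is a cylindrical channel of positive diameter parallel to $\mathbf e_{n+1}$ joining them that intersects none of the other cubes. An $n$-cube (orthogonal) visibility representation of a graph $G$ assigning each vertex to at most $t$ cubes: each vertex is assigned a nonempty set of at most $t$ cubes (all the cubes of the representation being pairwise disjoint), two distinct vertices are adjacent in $G$ if and only if some cube of one sees some cube of the other, and no two cubes assigned to the same vertex see each other. $h^{(n)}(G)$ (resp. $h^{(n)\perp}(G)$), the $n$-cube visibility number (resp. $n$-cube orthogonal visibility number), is the minimum $t$ for which such a representation exists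 in the standard (resp. orthogonal) model. $G$ is an $n$-cube (orthogonal) visibility graph if it has such a representation with exactly one cube per vertex. An $n$-cube (orthogonal) visibility tree is a tree that is an $n$-cube (orthogonal) visibility graph, and an $n$-cube (orthogonal) visibility forest is a disjoint union of $n$-cube (orthogonal) visibility trees. $\Upsilon_{h^{(n)}}(G)$, the $n$-cube arboricity (resp. $\Upsilon_{h^{(n)\perp}}(G)$, the $n$-cube orthogonal arboricity), is the minimum $k$ such that $G$ is the union of $k$ subgraphs each of which is an $n$-cube visibility forest (resp. $n$-cube orthogonal visibility forest). *)

theory Defs
  imports "HOL-Analysis.Analysis" "HOL-Library.Extended_Nat"
begin

section \<open>Finite simple graphs and trees\<close>

type_synonym 'v graph = "'v set \<times> 'v set set"

abbreviation verts :: "'v graph \<Rightarrow> 'v set" where "verts \<equiv> fst"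
abbreviation edges :: "'v graph \<Rightarrow> 'v set set" where "edges \<equiv> snd"

definition simple_graph :: "'v graph \<Rightarrow> bool" where
  "simple_graph G \<longleftrightarrow> finite (verts G) \<and>
     (\<forall>e\<in>edges G. \<exists>u\<in>verts G. \<exists>v\<in>verts G. u \<noteq> v \<and> e = {u, v})"

definition subgraph :: "'v graph \<Rightarrow> 'v graph \<Rightarrow> bool" where
  "subgraph H G \<longleftrightarrow> simple_graph H \<and> verts H \<subseteq> verts G \<and> edges H \<subseteq> edges G"

definition graph_union :: "'v graph set \<Rightarrow> 'v graph" where
  "graph_union \<G> = (\<Union>(verts ` \<G>), \<Union>(edges ` \<G>))"

definition graph_connected :: "'v graph \<Rightarrow> bool" where
  "graph_connected G \<longleftrightarrow>
     (\<forall>u\<in>verts G. \<forall>v\<in>verts G. (u, v) \<in> {(x, y). {x, y} \<in> edges G}\<^sup>*)"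

definition graph_cycle :: "'v graph \<Rightarrow> 'v list \<Rightarrow> bool" where
  "graph_cycle G c \<longleftrightarrow> length c \<ge> 3 \<and> distinct c \<and>
     (\<forall>i. Suc i < length c \<longrightarrow> {c ! i, c ! Suc i} \<in> edges G) \<and> {last c, hd c} \<in> edges G"

definition tree :: "'v graph \<Rightarrow> bool" where
  "tree G \<longleftrightarrow> simple_graph G \<and> verts G \<noteq> {} \<and> graph_connected G \<and> (\<nexists>c. graph_cycle G c)"

section \<open>Visibility along cylindrical channels\<close>

text \<open>The cross-section through \<open>p\<close>, orthogonal to the axis \<open>i\<close>, of a round cylinder.\<close>

definition disc :: "'a::euclidean_space \<Rightarrow> 'a \<Rightarrow> real \<Rightarrow> 'a set" where
  "disc i p r = {x. dist p x \<le> r \<and> (x - p) \<bullet> i = 0}"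

text \<open>The length \<open>l\<close> may be negative, so that the far base can lie on either side of \<open>p\<close>.\<close>

definition cylinder :: "'a::euclidean_space \<Rightarrow> 'a \<Rightarrow> real \<Rightarrow> real \<Rightarrow> 'a set" where
  "cylinder i p r l = (\<Union>x\<in>disc i p r. closed_segment x (x + l *\<^sub>R i))"

text \<open>
  \<open>D\<close> is the set of admissible axis directions and \<open>\<C>\<close> the set of all objects of the
  representation. The diameter of a cylinder is that of its cross-section. On the real line
  a cross-section is a single point and has diameter 0, so there nothing sees anything.
\<close>

definition sees :: "'a::euclidean_space set \<Rightarrow> 'a set set \<Rightarrow> 'a set \<Rightarrow> 'a set \<Rightarrow> bool" where
  "sees D \<C> A B \<longleftrightarrow> (\<exists>i\<in>D. \<exists>p r l.
     diameter (disc i p r) > 0 \<and>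
     disc i p r \<subseteq> A \<and> (\<lambda>x. x + l *\<^sub>R i) ` disc i p r \<subseteq> B \<and>
     (\<forall>C\<in>\<C> - {A, B}. cylinder i p r l \<inter> C = {}))"

section \<open>Representations\<close>

text \<open>
  \<open>K\<close> is the set of admissible objects; \<open>f v\<close> is the set of objects assigned to the vertex \<open>v\<close>.
\<close>

definition visibility_rep ::
  "'a::euclidean_space set set \<Rightarrow> 'a set \<Rightarrow> 'v graph \<Rightarrow> ('v \<Rightarrow> 'a set set) \<Rightarrow> bool" where
  "visibility_rep K D G f \<longleftrightarrow>
     (\<forall>v\<in>verts G. f v \<subseteq> K \<and> finite (f v) \<and> f v \<noteq> {}) \<and>
     (\<forall>u\<in>verts G. \<forall>v\<in>verts G. \<forall>A\<in>f u. \<forall>B\<in>f v. (u, A) \<noteq> (v, B) \<longrightarrow> A \<inter> B = {}) \<and>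
     (\<forall>u\<in>verts G. \<forall>v\<in>verts G. u \<noteq> v \<longrightarrow>
        ({u, v} \<in> edges G \<longleftrightarrow> (\<exists>A\<in>f u. \<exists>B\<in>f v. sees D (\<Union>(f ` verts G)) A B))) \<and>
     (\<forall>v\<in>verts G. \<forall>A\<in>f v. \<forall>B\<in>f v. A \<noteq> B \<longrightarrow> \<not> sees D (\<Union>(f ` verts G)) A B)"

text \<open>The value is \<open>\<infinity>\<close> if there is no representation.\<close>

definition visibility_number ::
  "'a::euclidean_space set set \<Rightarrow> 'a set \<Rightarrow> 'v graph \<Rightarrow> enat" where
  "visibility_number K D G =
     Inf {enat t |t. \<exists>f. visibility_rep K D G f \<and> (\<forall>v\<in>verts G. card (f v) \<le> t)}"

definition visibility_graph ::
  "'a::euclidean_space set set \<Rightarrow> 'a set \<Rightarrow> 'v graph \<Rightarrow> bool" where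
  "visibility_graph K D G \<longleftrightarrow>
     simple_graph G \<and> (\<exists>f. visibility_rep K D G f \<and> (\<forall>v\<in>verts G. card (f v) = 1))"

definition visibility_tree ::
  "'a::euclidean_space set set \<Rightarrow> 'a set \<Rightarrow> 'v graph \<Rightarrow> bool" where
  "visibility_tree K D G \<longleftrightarrow> tree G \<and> visibility_graph K D G"

definition visibility_forest ::
  "'a::euclidean_space set set \<Rightarrow> 'a set \<Rightarrow> 'v graph \<Rightarrow> bool" where
  "visibility_forest K D G \<longleftrightarrow> (\<exists>\<T>. finite \<T> \<and> (\<forall>T\<in>\<T>. visibility_tree K D T) \<and>
     (\<forall>S\<in>\<T>. \<forall>T\<in>\<T>. S \<noteq> T \<longrightarrow> verts S \<inter> verts T = {}) \<and> G = graph_union \<T>)"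

text \<open>The value is \<open>\<infinity>\<close> if there is no decomposition.\<close>

definition visibility_arboricity ::
  "'a::euclidean_space set set \<Rightarrow> 'a set \<Rightarrow> 'v graph \<Rightarrow> enat" where
  "visibility_arboricity K D G =
     Inf {enat k |k. \<exists>F :: nat \<Rightarrow> 'v graph.
       (\<forall>j<k. subgraph (F j) G \<and> visibility_forest K D (F j)) \<and> G = graph_union (F ` {..<k})}"

section \<open>The standard and the orthogonal model\<close>

text \<open>
  The dimension \<open>n\<close> is \<open>CARD('n)\<close>, and the ambient space of the orthogonal model, of dimension
  \<open>n + 1\<close>, is the product of \<open>real ^ 'n\<close> with a last coordinate axis spanned by \<open>(0, 1)\<close>.
\<close>

definition unit_cubes :: "(real ^ 'n::finite) set set" where
  "unit_cubes = {cbox a (a + One) |a. True}"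

definition orthogonal_unit_cubes :: "((real ^ 'n::finite) \<times> real) set set" where
  "orthogonal_unit_cubes = {cbox a (a + One) \<times> {c} |a c. True}"

definition cube_visibility_number :: "'n::finite itself \<Rightarrow> 'v graph \<Rightarrow> enat" where
  "cube_visibility_number _ G =
     visibility_number (unit_cubes :: (real ^ 'n) set set) Basis G"

definition cube_arboricity :: "'n::finite itself \<Rightarrow> 'v graph \<Rightarrow> enat" where
  "cube_arboricity _ G =
     visibility_arboricity (unit_cubes :: (real ^ 'n) set set) Basis G"

definition cube_orthogonal_visibility_number :: "'n::finite itself \<Rightarrow> 'v graph \<Rightarrow> enat" where
  "cube_orthogonal_visibility_number _ G =
     visibility_number (orthogonal_unit_cubes :: ((real ^ 'n) \<times> real) set set) {(0, 1)} G"

definition cube_orthogonal_arboricity :: "'n::finite itself \<Rightarrow> 'v graph \<Rightarrow> enat" where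
  "cube_orthogonal_arboricity _ G =
     visibility_arboricity (orthogonal_unit_cubes :: ((real ^ 'n) \<times> real) set set) {(0, 1)} G"

end

theory Submission imports Defs begin

text \<open>
  A decomposition into visibility forests gives a representation by placing those of the
  individual trees far apart from each other along the main diagonal.

  For the converse, measure the distance of two boxes of a representation by the maximum norm of
  the difference of their (slightly perturbed) positions. If removing other boxes makes \<open>A\<close> and
  \<open>B\<close> see each other, then the removed boxes between them form a chain from \<open>A\<close> to \<open>B\<close> which is
  a geodesic, because boxes on a common channel differ most along that channel. Realise every
  edge of the tree by a \<^emph>\<open>closest\<close> pair of boxes that see each other, and number the boxes of each
  vertex such that the two boxes realising an edge have the same number. The edges of number \<open>j\<close>
  form a forest. Inside one of its components keep only the boxes of number \<open>j\<close>. A new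
  visibility there would come from a geodesic chain, and this chain walks in the tree from one
  end of a path to the other; since the path is realised by closest pairs, the chain can only be
  the path itself, and by genericity of the positions it consists of boxes that were kept.
\<close>

section \<open>Walks in trees\<close>

abbreviation walk :: "'v graph \<Rightarrow> 'v list \<Rightarrow> bool" where
  "walk G \<equiv> successively (\<lambda>u v. {u, v} \<in> edges G)"

text \<open>The summand takes an ordered pair, so the same function adds up edge weights of a walk
  and height increments \<open>h y - h x\<close> along a chain of boxes; the latter
  telescope.\<close>

fun walk_weight :: "('a \<Rightarrow> 'a \<Rightarrow> real) \<Rightarrow> 'a list \<Rightarrow> real" where
  "walk_weight w (x # y # xs) = w x y + walk_weight w (y # xs)"
| "walk_weight w _ = 0"

lemma walk_weight_mono:
  assumes "successively (\<lambda>x y. w x y \<le> w' x y) xs"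
  shows "walk_weight w xs \<le> walk_weight w' xs"
  using assms by (induction w xs rule: walk_weight.induct) auto

lemma walk_weight_map: "walk_weight w (map f xs) = walk_weight (\<lambda>x y. w (f x) (f y)) xs"
  by (induction "\<lambda>x y. w (f x) (f y)" xs rule: walk_weight.induct) auto

lemma walk_weight_telescope:
  assumes "xs \<noteq> []"
  shows "walk_weight (\<lambda>x y. h y - h x) xs = h (last xs) - h (hd xs)"
  using assms by (induction "\<lambda>x y. h y - h x :: real" xs rule: walk_weight.induct) auto

lemma simple_graph_edgeD:
  assumes "simple_graph G" "{u, v} \<in> edges G"
  shows "u \<noteq> v" "u \<in> verts G" "v \<in> verts G"
  using assms unfolding simple_graph_def by (fastforce simp: doubleton_eq_iff)+

text \<open>Induction on the walk. If path and walk share their first step, both lose it. Otherwise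
  the walk turns off to some \<open>c\<close>, and \<open>c # p\<close> is again a path, with the
  same ends as the rest of the walk; passing from \<open>p\<close> to \<open>c # p\<close> and from
  the rest back to the whole walk each adds a positive weight. The two orientations of an edge may
  have different weights.\<close>

lemma walk_path_less:
  assumes G: "simple_graph G" "\<nexists>c. graph_cycle G c"
    and w: "\<And>u v. {u, v} \<in> edges G \<Longrightarrow> w u v > (0::real)"
  shows "walk G q \<Longrightarrow> q \<noteq> [] \<Longrightarrow> walk G p \<Longrightarrow> distinct p \<Longrightarrow> p \<noteq> [] \<Longrightarrow>
    hd p = hd q \<Longrightarrow> last p = last q \<Longrightarrow> p = q \<or> walk_weight w p < walk_weight w q"
proof (induction q arbitrary: p)
  case Nil
  then show ?case by simp
next
  case (Cons a q)
  note prems = Cons.prems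
  obtain p' where p: "p = a # p'" using prems by (cases p) auto
  show ?case
  proof (cases q)
    case Nil
    then have "p' = []" using prems p by (cases p') (auto split: if_splits)
    then show ?thesis using p Nil by simp
  next
    case q: (Cons c q')
    have ac: "{a, c} \<in> edges G" and wq: "walk G q" using prems q by (auto simp: successively_Cons)
    show ?thesis
    proof (cases "p' \<noteq> [] \<and> hd p' = c")
      case True
      then have "p' = q \<or> walk_weight w p' < walk_weight w q"
        using prems p q wq by (intro Cons.IH) (auto simp: successively_Cons)
      moreover obtain p'' where "p' = c # p''" using True by (cases p') auto
      ultimately show ?thesis using p q by auto
    next
      case False
      \<comment> \<open>An occurrence of \<open>c\<close> at a position at least 2 would close a
        cycle through the edge \<open>{a, c}\<close>; position 0 holds \<open>a\<close>, and
        position 1 is the case treated before.\<close>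
      have "c \<notin> set p"
      proof
        assume "c \<in> set p"
        then obtain i where i: "i < length p" "p ! i = c" by (auto simp: in_set_conv_nth)
        have "c \<noteq> a" using simple_graph_edgeD[OF G(1) ac] by simp
        then have "i \<noteq> 0" using i p by (metis nth_Cons_0)
        moreover have "i \<noteq> 1" using False i p by (cases p') auto
        ultimately have "2 \<le> i" by simp
        then have "graph_cycle G (take (Suc i) p)"
          using i prems p ac
          by (auto simp: graph_cycle_def last_conv_nth successively_conv_nth insert_commute
                   simp del: take_Suc_Cons)
        then show False using G(2) by blast
      qed
      moreover have "walk G (c # p)" using prems ac p by (auto simp: insert_commute)
      ultimately have "c # p = q \<or> walk_weight w (c # p) < walk_weight w q"
        using prems p q wq by (intro Cons.IH) auto
      moreover have "w a c > 0" "w c a > 0" using w[of a c] w[of c a] ac by (auto simp: insert_commute)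
      ultimately show ?thesis using p q by auto
    qed
  qed
qed

text \<open>If the paths differed, each would be strictly lighter than the other, with weight 1 on
  every edge.\<close>

lemma path_unique:
  assumes "simple_graph G" "\<nexists>c. graph_cycle G c"
    and "walk G p" "distinct p" "p \<noteq> []" "walk G q" "distinct q" "q \<noteq> []"
    and "hd p = hd q" "last p = last q"
  shows "p = q"
  using walk_path_less[of G "\<lambda>_ _. 1" p q] walk_path_less[of G "\<lambda>_ _. 1" q p] assms by fastforce

lemma rtrancl_imp_path:
  assumes "(u, v) \<in> {(x, y). {x, y} \<in> edges G}\<^sup>*"
  shows "\<exists>p. walk G p \<and> distinct p \<and> p \<noteq> [] \<and> hd p = u \<and> last p = v"
  using assms
proof (induction rule: converse_rtrancl_induct)
  case base
  then show ?case by (intro exI[of _ "[v]"]) auto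
next
  case (step y z)
  then obtain p where p: "walk G p" "distinct p" "p \<noteq> []" "hd p = z" "last p = v" by auto
  show ?case
  proof (cases "y \<in> set p")
    case True
    then obtain xs ys where "p = xs @ y # ys" by (auto simp: in_set_conv_decomp)
    then show ?thesis using p by (intro exI[of _ "y # ys"]) (auto simp: successively_append_iff)
  next
    case False
    then show ?thesis using p step.hyps
      by (intro exI[of _ "y # p"]) (auto simp: successively_Cons)
  qed
qed

text \<open>A tree grows by attaching one leaf at a time. This form of induction lets a labelling be
  extended to a new vertex while only one edge has to be respected.\<close>

lemma tree_vertex_induct:
  assumes T: "tree G"
    and single: "\<And>r. r \<in> verts G \<Longrightarrow> Q {r}"
    and insert: "\<And>W v w. W \<subseteq> verts G \<Longrightarrow> Q W \<Longrightarrow> w \<in> W \<Longrightarrow> v \<in> verts G - W \<Longrightarrow> {v, w} \<in> edges G \<Longrightarrow>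
      (\<And>w'. w' \<in> W \<Longrightarrow> {v, w'} \<in> edges G \<Longrightarrow> w' = w) \<Longrightarrow> Q (insert v W)"
  shows "Q (verts G)"
proof -
  have G: "simple_graph G" "\<nexists>c. graph_cycle G c" "graph_connected G"
    using T by (auto simp: tree_def)
  define path where "path W u v p \<longleftrightarrow> walk G p \<and> distinct p \<and> p \<noteq> [] \<and> hd p = u \<and> last p = v \<and> set p \<subseteq> W"
    for W u v p
  \<comment> \<open>Connectedness by paths inside \<open>W\<close> is carried along with
    \<open>Q\<close>, because it is what forbids a second neighbour of the new vertex. A maximal
    such \<open>W\<close> is then shown to contain all vertices.\<close>
  define \<W> where "\<W> = {W. W \<subseteq> verts G \<and> W \<noteq> {} \<and> Q W \<and> (\<forall>u\<in>W. \<forall>v\<in>W. \<exists>p. path W u v p)}"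
  obtain r where r: "r \<in> verts G" using T by (auto simp: tree_def)
  have "{r} \<in> \<W>" using r single by (auto simp: \<W>_def path_def intro!: exI[of _ "[r]"])
  moreover have "finite \<W>" using G(1) by (auto simp: \<W>_def simple_graph_def)
  ultimately obtain W where W: "W \<in> \<W>" and maxW: "\<And>W'. W' \<in> \<W> \<Longrightarrow> W \<subseteq> W' \<Longrightarrow> W = W'"
    using finite_has_maximal2[of \<W> "{r}"] by blast
  have paths: "\<forall>u\<in>W. \<forall>v\<in>W. \<exists>p. path W u v p" using W by (simp add: \<W>_def)
  have "verts G \<subseteq> W"
  proof (rule ccontr)
    assume "\<not> verts G \<subseteq> W"
    then obtain y x where "y \<in> verts G - W" "x \<in> W" "x \<in> verts G" using W by (auto simp: \<W>_def)
    then have "(x, y) \<in> {(x, y). {x, y} \<in> edges G}\<^sup>*" "x \<in> W" "y \<notin> W"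
      using G(3) by (auto simp: graph_connected_def)
    then obtain w v where wv: "w \<in> W" "v \<notin> W" "{w, v} \<in> edges G"
      by (induction rule: rtrancl_induct) auto
    then have v: "v \<in> verts G" "w \<noteq> v" using simple_graph_edgeD[OF G(1)] by blast+
    have uniq: "w' = w" if w': "w' \<in> W" "{v, w'} \<in> edges G" for w'
    proof (rule ccontr)
      assume "w' \<noteq> w"
      obtain p where p: "path W w w' p" using paths wv w' by blast
      \<comment> \<open>Both are paths from \<open>w\<close> to \<open>w'\<close>, yet
        \<open>p\<close> stays inside \<open>W\<close> while the other one passes through
        \<open>v\<close> outside.\<close>
      then have "p = [w, v, w']"
        using wv w' v \<open>w' \<noteq> w\<close>
        by (intro path_unique[OF G(1,2)]) (auto simp: path_def insert_commute)
      then show False using p wv by (auto simp: path_def)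
    qed
    have to_v: "\<exists>p. path (insert v W) u v p" if u: "u \<in> W" for u
    proof -
      obtain p where "path W u w p" using paths wv u by blast
      then show ?thesis using wv
        by (intro exI[of _ "p @ [v]"]) (auto simp: path_def successively_append_iff)
    qed
    have from_v: "\<exists>p. path (insert v W) v u p" if u: "u \<in> W" for u
    proof -
      obtain p where "path (insert v W) u v p" using to_v u by auto
      then show ?thesis
        by (intro exI[of _ "rev p"]) (auto simp: path_def hd_rev last_rev insert_commute)
    qed
    have "\<exists>p. path (insert v W) v v p" by (intro exI[of _ "[v]"]) (auto simp: path_def)
    moreover have "\<exists>p. path (insert v W) u u' p" if "u \<in> W" "u' \<in> W" for u u'
      using paths that unfolding path_def by (meson subset_insertI2)
    moreover have "Q (insert v W)"
    proof (rule insert)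
      show "W \<subseteq> verts G" "Q W" using W by (auto simp: \<W>_def)
      show "v \<in> verts G - W" "{v, w} \<in> edges G" using wv v by (auto simp: insert_commute)
    qed (use wv uniq in auto)
    ultimately have "insert v W \<in> \<W>"
      using W v to_v from_v by (simp add: \<W>_def)
    then show False using maxW[of "insert v W"] wv by auto
  qed
  then show ?thesis using W by (auto simp: \<W>_def dest: subset_antisym)
qed

text \<open>Take any injection \<open>g\<close> into \<open>{..<t}\<close> and compose it with the
  transposition of \<open>g a\<close> and \<open>c\<close>.\<close>

lemma inj_on_extend_point:
  assumes "finite A" "card A \<le> t" "a \<in> A" "c < t"
  shows "\<exists>g. inj_on g A \<and> g ` A \<subseteq> {..<t} \<and> g a = c"
proof -
  obtain g where g: "inj_on g A" "g ` A \<subseteq> {..<t}"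
    using card_le_inj[of A "{..<t}"] assms by auto
  have "g a < t" using g assms by auto
  let ?h = "\<lambda>x. if g x = c then g a else if g x = g a then c else g x"
  have "inj_on ?h A" using g(1) by (auto simp: inj_on_def)
  moreover have "?h ` A \<subseteq> {..<t}" using g(2) \<open>g a < t\<close> assms(4) by auto
  ultimately show ?thesis by (intro exI[of _ ?h]) auto
qed

section \<open>Boxes of a fixed shape\<close>

lemma disc_radius_pos:
  assumes "diameter (disc i p r) > 0"
  shows "r > 0"
proof (rule ccontr)
  assume "\<not> r > 0"
  then have "x = p" if "dist p x \<le> r" for x
    using that zero_le_dist[of p x] by (metis dist_le_zero_iff dual_order.trans linorder_not_le)
  then have "disc i p r \<subseteq> {p}" by (auto simp: disc_def)
  then show False using assms by (auto simp: subset_singleton_iff)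
qed

lemma disc_orthogonal_direction:
  assumes "diameter (disc i p r) > 0"
  obtains v where "v \<noteq> 0" "v \<bullet> i = 0"
proof -
  have "\<not> disc i p r \<subseteq> {p}" using assms by (auto simp: subset_singleton_iff)
  then obtain x where "x \<noteq> p" "(x - p) \<bullet> i = 0" by (auto simp: disc_def)
  then show ?thesis using that[of "x - p"] by auto
qed

text \<open>The assumption on a disc with the same axis supplies a direction orthogonal to
  \<open>i\<close>; it excludes the real line, where discs of every radius are points. In that
  direction a positive radius \<open>r'\<close> yields two points at distance
  \<open>r'\<close>.\<close>

lemma diameter_disc_pos:
  assumes "diameter (disc i p r) > 0" "r' > 0"
  shows "diameter (disc i p' r') > 0"
proof -
  obtain v where v: "v \<noteq> 0" "v \<bullet> i = 0" using disc_orthogonal_direction[OF assms(1)] .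
  define y where "y = p' + (r' / norm v) *\<^sub>R v"
  have "y \<in> disc i p' r'" "p' \<in> disc i p' r'" "dist y p' = r'"
    using assms(2) v by (auto simp: y_def disc_def dist_norm)
  moreover have "bounded (disc i p' r')"
    by (rule bounded_subset[of "cball p' r'"]) (auto simp: disc_def)
  ultimately show ?thesis
    using diameter_bounded_bound[of "disc i p' r'" y p'] assms(2) by auto
qed

lemma disc_other_axis:
  fixes p :: "'a::euclidean_space"
  assumes "diameter (disc i p r) > 0"
  shows "\<exists>b\<in>Basis. b \<noteq> i"
proof -
  obtain v where "v \<noteq> 0" "v \<bullet> i = 0" using disc_orthogonal_direction[OF assms] .
  then show ?thesis using euclidean_eq_iff[of v 0] by auto
qed

lemma sees_sym:
  assumes "sees D \<C> A B"
  shows "sees D \<C> B A"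
proof -
  obtain i p r l where *: "i \<in> D" "diameter (disc i p r) > 0" "disc i p r \<subseteq> A"
    "(\<lambda>x. x + l *\<^sub>R i) ` disc i p r \<subseteq> B" "\<forall>C\<in>\<C> - {A, B}. cylinder i p r l \<inter> C = {}"
    using assms by (auto simp: sees_def)
  have disc: "disc i (p + l *\<^sub>R i) r = (\<lambda>x. x + l *\<^sub>R i) ` disc i p r" (is "?L = ?R")
  proof
    show "?L \<subseteq> ?R"
    proof
      fix x assume "x \<in> ?L"
      then have "x - l *\<^sub>R i \<in> disc i p r" by (simp add: disc_def dist_norm algebra_simps)
      then show "x \<in> ?R" by (force intro: image_eqI[of _ _ "x - l *\<^sub>R i"])
    qed
    show "?R \<subseteq> ?L" by (auto simp: disc_def dist_norm)
  qed
  have "cylinder i (p + l *\<^sub>R i) r (- l) = cylinder i p r l"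
    unfolding cylinder_def disc by (simp add: closed_segment_commute)
  moreover have "diameter ?L > 0" using diameter_disc_pos[OF *(2) disc_radius_pos[OF *(2)]] .
  moreover have "(\<lambda>x. x + (- l) *\<^sub>R i) ` ?L = disc i p r" unfolding disc by (auto simp: image_image)
  ultimately show ?thesis unfolding sees_def using *
    by (intro bexI[of _ i] exI[of _ "p + l *\<^sub>R i"] exI[of _ r] exI[of _ "- l"]) (auto simp: disc)
qed

lemma sees_translate:
  assumes "sees D \<C> A B"
  shows "sees D ((`) ((+) z) ` \<C>) ((+) z ` A) ((+) z ` B)"
proof -
  obtain i p r l where *: "i \<in> D" "diameter (disc i p r) > 0" "disc i p r \<subseteq> A"
    "(\<lambda>x. x + l *\<^sub>R i) ` disc i p r \<subseteq> B" "\<And>C. C \<in> \<C> \<Longrightarrow> C \<noteq> A \<Longrightarrow> C \<noteq> B \<Longrightarrow> cylinder i p r l \<inter> C = {}"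
    using assms by (auto simp: sees_def)
  have disc: "disc i (z + p) r = (+) z ` disc i p r" (is "?L = ?R")
  proof
    show "?L \<subseteq> ?R"
    proof
      fix x assume "x \<in> ?L"
      then have "x - z \<in> disc i p r" by (simp add: disc_def dist_norm algebra_simps)
      then show "x \<in> ?R" by (force intro: image_eqI[of _ _ "x - z"])
    qed
    show "?R \<subseteq> ?L" by (auto simp: disc_def dist_norm)
  qed
  have cyl: "cylinder i (z + p) r l = (+) z ` cylinder i p r l"
    unfolding cylinder_def disc by (simp add: closed_segment_translation image_UN add.assoc)
  have "diameter (disc i (z + p) r) > 0" using diameter_disc_pos[OF *(2) disc_radius_pos[OF *(2)]] .
  moreover have "(\<lambda>x. x + l *\<^sub>R i) ` disc i (z + p) r \<subseteq> (+) z ` B"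
    using *(4) by (auto simp: disc add.assoc)
  moreover have cyl_free: "cylinder i (z + p) r l \<inter> (+) z ` C = {}"
    if "C \<in> \<C>" "(+) z ` C \<noteq> (+) z ` A" "(+) z ` C \<noteq> (+) z ` B" for C
  proof -
    have "C \<noteq> A" "C \<noteq> B" using that by auto
    then have "cylinder i p r l \<inter> C = {}" using *(5) that(1) by blast
    then show ?thesis unfolding cyl by auto
  qed
  ultimately show ?thesis unfolding sees_def
  proof (rule_tac bexI[OF _ *(1)], rule_tac exI[of _ "z + p"], rule_tac exI[of _ r], rule_tac exI[of _ l],
      intro conjI ballI)
    show "disc i (z + p) r \<subseteq> (+) z ` A" unfolding disc using *(3) by (rule image_mono)
    fix C' assume "C' \<in> (`) ((+) z) ` \<C> - {(+) z ` A, (+) z ` B}"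
    then show "cylinder i (z + p) r l \<inter> C' = {}" using cyl_free by auto
  qed
qed

lemma sees_mono: "sees D \<C> A B \<Longrightarrow> \<C>' \<subseteq> \<C> \<Longrightarrow> sees D \<C>' A B"
  unfolding sees_def by (meson Diff_mono subset_iff order_refl)

text \<open>The ball shrinks for one set at a time: if it is not contained in the closed set
  \<open>S\<close>, then it contains a smaller ball in the complement of \<open>S\<close>. Applied
  to tubes, this thins a channel until each tube contains it or misses it.\<close>

lemma ball_in_or_out_closed:
  assumes "finite \<S>" "\<And>S. S \<in> \<S> \<Longrightarrow> closed S" "r > 0"
  shows "\<exists>q \<rho>. \<rho> > 0 \<and> ball q \<rho> \<subseteq> ball p r \<and> (\<forall>S\<in>\<S>. ball q \<rho> \<subseteq> S \<or> ball q \<rho> \<inter> S = {})"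
  using assms
proof (induction \<S> rule: finite_induct)
  case empty
  then show ?case by auto
next
  case (insert S \<S>)
  then obtain q \<rho> where q: "\<rho> > 0" "ball q \<rho> \<subseteq> ball p r" "\<forall>S\<in>\<S>. ball q \<rho> \<subseteq> S \<or> ball q \<rho> \<inter> S = {}"
    by auto
  show ?case
  proof (cases "ball q \<rho> \<subseteq> S")
    case True
    then show ?thesis using q by auto
  next
    case False
    then obtain q' where "q' \<in> ball q \<rho> - S" by blast
    moreover have "open (ball q \<rho> - S)" using insert.prems by (intro open_Diff) auto
    ultimately obtain \<rho>' where "\<rho>' > 0" "ball q' \<rho>' \<subseteq> ball q \<rho> - S"
      by (meson open_contains_ball)
    then show ?thesis using q by (intro exI[of _ q'] exI[of _ \<rho>']) blast
  qed
qed

text \<open>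
  The shape \<open>One\<close> with all axes as directions is the standard model; the degenerate shape
  \<open>(One, 0)\<close> with the last axis as the only direction is the orthogonal one.
\<close>

locale box_model =
  fixes s :: "'a::euclidean_space" and D :: "'a set"
  assumes D_Basis: "D \<subseteq> Basis"
    and s_nonneg: "b \<in> Basis \<Longrightarrow> 0 \<le> s \<bullet> b"
    and s_eq: "i \<in> D \<Longrightarrow> j \<in> D \<Longrightarrow> s \<bullet> i = s \<bullet> j"
begin

section \<open>Boxes of shape \<open>s\<close>, their tubes, and visibility in coordinates\<close>

definition boxes :: "'a set set" where
  "boxes = {cbox a (a + s) |a. True}"

definition corner :: "'a set \<Rightarrow> 'a" where
  "corner C = (SOME a. C = cbox a (a + s))"

text \<open>The box prolonged to infinity in both directions along the axis \<open>i\<close>.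
  Leaving the coordinate \<open>i\<close> free makes it invariant under shifts along
  \<open>i\<close>.\<close>

definition tube :: "'a \<Rightarrow> 'a set \<Rightarrow> 'a set" where
  "tube i C = {x. \<forall>b\<in>Basis - {i}. corner C \<bullet> b \<le> x \<bullet> b \<and> x \<bullet> b \<le> corner C \<bullet> b + s \<bullet> b}"

lemma boxes_corner: "C \<in> boxes \<Longrightarrow> C = cbox (corner C) (corner C + s)"
  unfolding boxes_def corner_def by (rule someI_ex) auto

lemma corner_cbox [simp]: "corner (cbox a (a + s)) = a"
proof -
  have "cbox a (a + s) = cbox (corner (cbox a (a + s))) (corner (cbox a (a + s)) + s)"
    by (rule boxes_corner) (auto simp: boxes_def)
  moreover have "cbox a (a + s) \<noteq> {}" using s_nonneg by (auto simp: box_ne_empty inner_simps)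
  ultimately show ?thesis using eq_cbox by metis
qed

lemma translate_box:
  assumes "C \<in> boxes"
  shows "(+) z ` C \<in> boxes" "corner ((+) z ` C) = z + corner C"
proof -
  have "(+) z ` C = cbox (z + corner C) (z + corner C + s)"
    using boxes_corner[OF assms] cbox_translation[of z "corner C" "corner C + s"] by (metis add.assoc)
  then show "(+) z ` C \<in> boxes" "corner ((+) z ` C) = z + corner C" by (auto simp: boxes_def)
qed

lemma mem_box_iff_tube:
  assumes "C \<in> boxes" "i \<in> Basis"
  shows "x \<in> C \<longleftrightarrow> x \<in> tube i C \<and> corner C \<bullet> i \<le> x \<bullet> i \<and> x \<bullet> i \<le> corner C \<bullet> i + s \<bullet> i"
proof -
  have "x \<in> C \<longleftrightarrow> x \<in> cbox (corner C) (corner C + s)" using boxes_corner[OF assms(1)] by simp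
  then show ?thesis using assms(2) by (auto simp: tube_def mem_box inner_simps)
qed

lemma closed_tube: "closed (tube i C)"
proof -
  have "tube i C = (\<Inter>b\<in>Basis - {i}. {x. corner C \<bullet> b \<le> x \<bullet> b} \<inter> {x. x \<bullet> b \<le> corner C \<bullet> b + s \<bullet> b})"
    by (auto simp: tube_def)
  also have "closed \<dots>"
    by (intro closed_INT ballI closed_Int closed_Collect_le continuous_intros)
  finally show ?thesis .
qed

lemma tube_shift:
  assumes "i \<in> Basis"
  shows "x + t *\<^sub>R i \<in> tube i C \<longleftrightarrow> x \<in> tube i C"
  using assms by (auto simp: tube_def inner_simps inner_Basis)

lemma tube_disjoint_boxes:
  assumes "P \<in> boxes" "Q \<in> boxes" "P \<inter> Q = {}" "x \<in> tube i P" "x \<in> tube i Q" "i \<in> Basis"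
  shows "corner P \<bullet> i + s \<bullet> i < corner Q \<bullet> i \<or> corner Q \<bullet> i + s \<bullet> i < corner P \<bullet> i"
proof (rule ccontr)
  assume *: "\<not> ?thesis"
  \<comment> \<open>This is \<open>x\<close> shifted along \<open>i\<close> to the larger of the two
    lower ends. If the two intervals on the axis \<open>i\<close> met, this point would lie in both
    boxes.\<close>
  define y where "y = x + (max (corner P \<bullet> i) (corner Q \<bullet> i) - x \<bullet> i) *\<^sub>R i"
  have "y \<in> tube i P" "y \<in> tube i Q" "y \<bullet> i = max (corner P \<bullet> i) (corner Q \<bullet> i)"
    using assms by (auto simp: y_def tube_shift inner_simps)
  then have "y \<in> P" "y \<in> Q"
    using * assms(1,2,6) s_nonneg[of i] by (auto simp: mem_box_iff_tube[OF _ assms(6)])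
  then show False using assms(3) by auto
qed

lemma tube_corner_diff:
  assumes "x \<in> tube i P" "x \<in> tube i Q" "j \<in> Basis" "j \<noteq> i"
  shows "\<bar>corner P \<bullet> j - corner Q \<bullet> j\<bar> \<le> s \<bullet> j"
proof -
  have "corner P \<bullet> j \<le> x \<bullet> j \<and> x \<bullet> j \<le> corner P \<bullet> j + s \<bullet> j"
    "corner Q \<bullet> j \<le> x \<bullet> j \<and> x \<bullet> j \<le> corner Q \<bullet> j + s \<bullet> j"
    using assms by (auto simp: tube_def)
  then show ?thesis by linarith
qed

text \<open>The cross-section is replaced by a full ball, which is harmless since tubes do not
  depend on the coordinate \<open>i\<close>; an uninterrupted channel then means that no further box
  whose tube meets the ball has its lower end strictly between the two boxes.\<close>

lemma sees_boxE:
  assumes "sees D \<X> A B" "A \<in> boxes" "B \<in> boxes"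
  obtains i p r where "i \<in> D" "r > 0" "diameter (disc i p r) > 0"
    "ball p r \<subseteq> tube i A" "ball p r \<subseteq> tube i B"
    "\<And>C. C \<in> \<X> \<Longrightarrow> C \<in> boxes \<Longrightarrow> C \<noteq> A \<Longrightarrow> C \<noteq> B \<Longrightarrow> ball p r \<inter> tube i C \<noteq> {} \<Longrightarrow>
      corner A \<bullet> i + s \<bullet> i < corner C \<bullet> i \<and> corner C \<bullet> i < corner B \<bullet> i \<or>
      corner B \<bullet> i + s \<bullet> i < corner C \<bullet> i \<and> corner C \<bullet> i < corner A \<bullet> i \<Longrightarrow> False"
proof -
  obtain i p r l where *: "i \<in> D" "diameter (disc i p r) > 0" "disc i p r \<subseteq> A"
    "(\<lambda>x. x + l *\<^sub>R i) ` disc i p r \<subseteq> B" "\<forall>C\<in>\<X> - {A, B}. cylinder i p r l \<inter> C = {}"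
    using assms by (auto simp: sees_def)
  have i: "i \<in> Basis" using *(1) D_Basis by auto
  have r: "r > 0" using disc_radius_pos[OF *(2)] .
  \<comment> \<open>Orthogonal projection to the hyperplane of the disc. It does not increase the
    distance to \<open>p\<close>, so it maps the ball into the disc, and it moves points only along
    \<open>i\<close>, so it respects tubes.\<close>
  define proj where "proj y = y + (- ((y - p) \<bullet> i)) *\<^sub>R i" for y
  have proj: "proj y \<in> disc i p r" if "y \<in> ball p r" for y
  proof -
    have "norm (proj y - p) \<le> norm (y - p)"
    proof (rule norm_le_componentwise)
      fix b :: 'a assume "b \<in> Basis"
      then show "\<bar>(proj y - p) \<bullet> b\<bar> \<le> \<bar>(y - p) \<bullet> b\<bar>"
        using i by (auto simp: proj_def inner_simps inner_Basis)
    qed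
    then show ?thesis using that i by (auto simp: disc_def dist_norm norm_minus_commute proj_def inner_simps)
  qed
  have inA: "proj y \<in> A" and inB: "proj y + l *\<^sub>R i \<in> B" if "y \<in> ball p r" for y
    using proj[OF that] *(3,4) by auto
  have tube_proj: "proj y \<in> tube i C \<longleftrightarrow> y \<in> tube i C" for y C
    unfolding proj_def by (rule tube_shift[OF i])
  show ?thesis
  proof (rule that[OF *(1) r *(2)])
    show "ball p r \<subseteq> tube i A"
      using inA tube_proj mem_box_iff_tube[OF assms(2) i] by blast
    show "ball p r \<subseteq> tube i B"
      using inB tube_proj tube_shift[OF i] mem_box_iff_tube[OF assms(3) i] by blast
  next
    fix C assume C: "C \<in> \<X>" "C \<in> boxes" "C \<noteq> A" "C \<noteq> B" "ball p r \<inter> tube i C \<noteq> {}"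
      "corner A \<bullet> i + s \<bullet> i < corner C \<bullet> i \<and> corner C \<bullet> i < corner B \<bullet> i \<or>
       corner B \<bullet> i + s \<bullet> i < corner C \<bullet> i \<and> corner C \<bullet> i < corner A \<bullet> i"
    then obtain y where y: "y \<in> ball p r" "y \<in> tube i C" by auto
    have "corner A \<bullet> i \<le> proj y \<bullet> i" "proj y \<bullet> i \<le> corner A \<bullet> i + s \<bullet> i"
      "corner B \<bullet> i \<le> proj y \<bullet> i + l" "proj y \<bullet> i + l \<le> corner B \<bullet> i + s \<bullet> i"
      using inA[OF y(1)] inB[OF y(1)] i
      by (auto simp: mem_box_iff_tube[OF assms(2) i] mem_box_iff_tube[OF assms(3) i] inner_simps)
    then have bt: "proj y \<bullet> i < corner C \<bullet> i \<and> corner C \<bullet> i < proj y \<bullet> i + l \<or>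
        proj y \<bullet> i + l < corner C \<bullet> i \<and> corner C \<bullet> i < proj y \<bullet> i"
      using C by auto
    \<comment> \<open>The parameter at which the axis-parallel segment starting at
      \<open>proj y\<close> reaches the lower end of \<open>C\<close>; the alternatives in
      \<open>bt\<close> force \<open>l\<close> to be nonzero.\<close>
    define u where "u = (corner C \<bullet> i - proj y \<bullet> i) / l"
    have u: "0 \<le> u" "u \<le> 1" "u * l = corner C \<bullet> i - proj y \<bullet> i"
      using bt by (auto simp: u_def field_simps)
    let ?z = "proj y + (u * l) *\<^sub>R i"
    have "?z = (1 - u) *\<^sub>R proj y + u *\<^sub>R (proj y + l *\<^sub>R i)" by (simp add: algebra_simps)
    then have "?z \<in> closed_segment (proj y) (proj y + l *\<^sub>R i)"
      unfolding closed_segment_def using u by blast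
    then have "?z \<in> cylinder i p r l" using proj[OF y(1)] by (auto simp: cylinder_def)
    moreover have "?z \<in> C"
      using y i s_nonneg[OF i] u
      by (auto simp: mem_box_iff_tube[OF C(2) i] tube_shift[OF i] tube_proj inner_simps)
    ultimately show False using *(5) C by auto
  qed
qed

text \<open>The channel runs from the upper face of \<open>A\<close> to the lower face of
  \<open>B\<close>. All boxes have the same extent along \<open>i\<close>, so a box starting below
  \<open>A\<close> ends below the upper face of \<open>A\<close> and cannot block; comparing lower
  ends is therefore enough.\<close>

lemma sees_boxI:
  assumes i: "i \<in> D" and nontriv: "diameter (disc i p r) > 0"
    and AB: "A \<in> boxes" "B \<in> boxes" "corner A \<bullet> i + s \<bullet> i \<le> corner B \<bullet> i"
    and \<rho>: "\<rho> > 0" "ball q \<rho> \<subseteq> tube i A" "ball q \<rho> \<subseteq> tube i B"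
    and free: "\<And>C. C \<in> \<C> \<Longrightarrow> C \<noteq> A \<Longrightarrow> C \<noteq> B \<Longrightarrow> C \<in> boxes \<and> (ball q \<rho> \<inter> tube i C = {} \<or>
      corner C \<bullet> i < corner A \<bullet> i \<or> corner B \<bullet> i < corner C \<bullet> i)"
  shows "sees D \<C> A B"
proof -
  have iB: "i \<in> Basis" using i D_Basis by auto
  define \<tau> where "\<tau> = corner A \<bullet> i + s \<bullet> i - q \<bullet> i"
  define p' where "p' = q + \<tau> *\<^sub>R i"
  define l where "l = corner B \<bullet> i - (corner A \<bullet> i + s \<bullet> i)"
  have p'i: "p' \<bullet> i = corner A \<bullet> i + s \<bullet> i" using iB by (simp add: p'_def \<tau>_def inner_simps)
  have l: "l \<ge> 0" using AB by (simp add: l_def)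
  \<comment> \<open>Half the radius is used because discs are closed and the ball is open.\<close>
  have disc: "x - \<tau> *\<^sub>R i \<in> ball q \<rho>" "x \<bullet> i = corner A \<bullet> i + s \<bullet> i" if "x \<in> disc i p' (\<rho> / 2)" for x
    using that \<rho>(1) p'i by (auto simp: disc_def dist_norm p'_def algebra_simps)
  have tube: "x \<in> tube i C \<longleftrightarrow> x - \<tau> *\<^sub>R i \<in> tube i C" for x C
    using tube_shift[OF iB, of "x - \<tau> *\<^sub>R i" \<tau> C] by simp
  have "disc i p' (\<rho> / 2) \<subseteq> A"
    using disc \<rho>(2) tube s_nonneg[OF iB] by (fastforce simp: mem_box_iff_tube[OF AB(1) iB])
  moreover have "(\<lambda>x. x + l *\<^sub>R i) ` disc i p' (\<rho> / 2) \<subseteq> B"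
  proof safe
    fix x assume x: "x \<in> disc i p' (\<rho> / 2)"
    have "x \<in> tube i B" using disc(1)[OF x] \<rho>(3) tube by blast
    then show "x + l *\<^sub>R i \<in> B" using disc(2)[OF x] iB s_nonneg[OF iB]
      by (auto simp: mem_box_iff_tube[OF AB(2) iB] tube_shift[OF iB] inner_simps l_def)
  qed
  moreover have "cylinder i p' (\<rho> / 2) l \<inter> C = {}" if "C \<in> \<C> - {A, B}" for C
  proof (rule ccontr)
    assume "cylinder i p' (\<rho> / 2) l \<inter> C \<noteq> {}"
    then obtain x y where x: "x \<in> disc i p' (\<rho> / 2)" "y \<in> closed_segment x (x + l *\<^sub>R i)" "y \<in> C"
      by (auto simp: cylinder_def)
    then obtain u where u: "0 \<le> u" "u \<le> 1" "y = (1 - u) *\<^sub>R x + u *\<^sub>R (x + l *\<^sub>R i)"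
      by (auto simp: closed_segment_def)
    then have y: "y = x + (u * l) *\<^sub>R i" by (simp add: algebra_simps)
    have "C \<in> boxes" and C: "ball q \<rho> \<inter> tube i C = {} \<or>
      corner C \<bullet> i < corner A \<bullet> i \<or> corner B \<bullet> i < corner C \<bullet> i"
      using free that by auto
    then have yC: "y \<in> tube i C" "corner C \<bullet> i \<le> y \<bullet> i" "y \<bullet> i \<le> corner C \<bullet> i + s \<bullet> i"
      using x(3) mem_box_iff_tube[OF _ iB] by blast+
    have "x - \<tau> *\<^sub>R i \<in> tube i C" using yC(1) tube unfolding y tube_shift[OF iB] by blast
    moreover have "y \<bullet> i = corner A \<bullet> i + s \<bullet> i + u * l" using y disc(2)[OF x(1)] iB by (simp add: inner_simps)
    moreover have "0 \<le> u * l" "u * l \<le> l" using u l by (auto simp: mult_left_le_one_le)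
    ultimately show False using disc(1)[OF x(1)] C yC(2,3) unfolding l_def by auto
  qed
  moreover have "diameter (disc i p' (\<rho> / 2)) > 0" using diameter_disc_pos[OF nontriv] \<rho> by auto
  ultimately show ?thesis unfolding sees_def
    by (intro bexI[OF _ i] exI[of _ p'] exI[of _ "\<rho> / 2"] exI[of _ l] conjI ballI)
qed

section \<open>From a sighting in a subfamily to a chain in the whole family\<close>

text \<open>Thin the channel between \<open>A\<close> and \<open>B\<close> so that every tube of
  \<open>\<C>\<close> contains it or misses it. The boxes whose tubes contain it are linearly
  ordered along \<open>i\<close>, and neighbours in this order see each other in
  \<open>\<C>\<close>. The order may put \<open>B\<close> first, hence the disjunction about the
  ends.\<close>

lemma sees_chain:
  assumes fin: "finite \<C>" and box: "\<C> \<subseteq> boxes"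
    and disj: "\<And>P Q. P \<in> \<C> \<Longrightarrow> Q \<in> \<C> \<Longrightarrow> P \<noteq> Q \<Longrightarrow> P \<inter> Q = {}"
    and sub: "\<X> \<subseteq> \<C>" and AB: "A \<in> \<X>" "B \<in> \<X>" "A \<noteq> B" and sees: "sees D \<X> A B"
  obtains i cs where "i \<in> D" "length cs \<ge> 2" "hd cs = A \<and> last cs = B \<or> hd cs = B \<and> last cs = A"
    "successively (\<lambda>P Q. sees D \<C> P Q \<and> tube i P \<inter> tube i Q \<noteq> {} \<and> corner P \<bullet> i < corner Q \<bullet> i) cs"
    "set cs \<subseteq> \<C>" "set cs \<inter> \<X> \<subseteq> {A, B}" "distinct cs"
proof -
  \<comment> \<open>The case of \<open>A\<close> below \<open>B\<close>, with \<open>A\<close> and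
    \<open>B\<close> generalised so that it also serves the opposite case.\<close>
  have "\<exists>i cs. i \<in> D \<and> length cs \<ge> 2 \<and> hd cs = A \<and> last cs = B \<and>
    successively (\<lambda>P Q. sees D \<C> P Q \<and> tube i P \<inter> tube i Q \<noteq> {} \<and> corner P \<bullet> i < corner Q \<bullet> i) cs \<and>
    set cs \<subseteq> \<C> \<and> set cs \<inter> \<X> \<subseteq> {A, B} \<and> distinct cs"
    if i: "i \<in> D" and r: "r > 0" and nontriv: "diameter (disc i p r) > 0"
    and tubes: "ball p r \<subseteq> tube i A" "ball p r \<subseteq> tube i B"
    and free: "\<And>C. C \<in> \<X> \<Longrightarrow> C \<in> boxes \<Longrightarrow> C \<noteq> A \<Longrightarrow> C \<noteq> B \<Longrightarrow> ball p r \<inter> tube i C \<noteq> {} \<Longrightarrow>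
      corner A \<bullet> i + s \<bullet> i < corner C \<bullet> i \<Longrightarrow> corner C \<bullet> i < corner B \<bullet> i \<Longrightarrow> False"
    and less: "corner A \<bullet> i < corner B \<bullet> i" and AB: "A \<in> \<X>" "B \<in> \<X>"
    for i p r A B
  proof -
    have iB: "i \<in> Basis" using i D_Basis by auto
    obtain q \<rho> where \<rho>: "\<rho> > 0" "ball q \<rho> \<subseteq> ball p r"
      "\<And>C. C \<in> \<C> \<Longrightarrow> ball q \<rho> \<subseteq> tube i C \<or> ball q \<rho> \<inter> tube i C = {}"
      using ball_in_or_out_closed[of "tube i ` \<C>" r p] fin r closed_tube by force
    then have q: "q \<in> ball q \<rho>" by simp
    \<comment> \<open>The boxes lying across the thinned channel; by the choice of the ball, all
      others have tubes that miss it.\<close>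
    define L where "L = {C \<in> \<C>. ball q \<rho> \<subseteq> tube i C}"
    have finL: "finite L" using fin by (simp add: L_def)
    have sep: "corner P \<bullet> i + s \<bullet> i < corner Q \<bullet> i \<or> corner Q \<bullet> i + s \<bullet> i < corner P \<bullet> i"
      if "P \<in> L" "Q \<in> L" "P \<noteq> Q" for P Q
    proof (rule tube_disjoint_boxes[OF _ _ _ _ _ iB])
      show "P \<in> boxes" "Q \<in> boxes" using that box by (auto simp: L_def)
      show "P \<inter> Q = {}" using that disj by (simp add: L_def)
      show "q \<in> tube i P" "q \<in> tube i Q" using that q unfolding L_def by blast+
    qed
    have ABL: "A \<in> L" "B \<in> L" using AB sub tubes \<rho>(2) by (auto simp: L_def)
    have tubeL: "tube i P \<inter> tube i Q \<noteq> {}" if "P \<in> L" "Q \<in> L" for P Q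
      using that q unfolding L_def by blast
    \<comment> \<open>Induction on the number of boxes of \<open>L\<close> above \<open>P\<close>
      and up to \<open>Q\<close>: the chain steps from \<open>P\<close> to the lowest of them,
      \<open>N\<close>, and continues from there.\<close>
    have chain: "\<exists>cs. length cs \<ge> 2 \<and> hd cs = P \<and> last cs = Q \<and>
      successively (\<lambda>P Q. sees D \<C> P Q \<and> tube i P \<inter> tube i Q \<noteq> {} \<and> corner P \<bullet> i < corner Q \<bullet> i) cs \<and>
      set cs \<subseteq> {C \<in> L. corner P \<bullet> i \<le> corner C \<bullet> i \<and> corner C \<bullet> i \<le> corner Q \<bullet> i} \<and> distinct cs"
      if "P \<in> L" "Q \<in> L" "corner P \<bullet> i < corner Q \<bullet> i" for P Q
      using that
    proof (induction "card {C \<in> L. corner P \<bullet> i < corner C \<bullet> i \<and> corner C \<bullet> i \<le> corner Q \<bullet> i}"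
        arbitrary: P rule: less_induct)
      case less
      define M where "M = {C \<in> L. corner P \<bullet> i < corner C \<bullet> i \<and> corner C \<bullet> i \<le> corner Q \<bullet> i}"
      have "finite M" "Q \<in> M" using finL less.prems by (auto simp: M_def)
      then obtain N where N: "N \<in> M" "\<And>C. C \<in> M \<Longrightarrow> corner N \<bullet> i \<le> corner C \<bullet> i"
        using ex_is_arg_min_if_finite[of M "\<lambda>C. corner C \<bullet> i"] by (auto simp: is_arg_min_linorder)
      then have NL: "N \<in> L" "corner P \<bullet> i < corner N \<bullet> i" "corner N \<bullet> i \<le> corner Q \<bullet> i"
        by (auto simp: M_def)
      have PN: "sees D \<C> P N"
      proof (rule sees_boxI[OF i nontriv _ _ _ \<rho>(1)])
        show "P \<in> boxes" "N \<in> boxes" "ball q \<rho> \<subseteq> tube i P" "ball q \<rho> \<subseteq> tube i N"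
          using less.prems NL box by (auto simp: L_def)
        show "corner P \<bullet> i + s \<bullet> i \<le> corner N \<bullet> i"
          using sep[of P N] less.prems NL s_nonneg[OF iB] by fastforce
        fix C assume C: "C \<in> \<C>" "C \<noteq> P" "C \<noteq> N"
        show "C \<in> boxes \<and> (ball q \<rho> \<inter> tube i C = {} \<or>
          corner C \<bullet> i < corner P \<bullet> i \<or> corner N \<bullet> i < corner C \<bullet> i)"
        proof (cases "C \<in> L")
          case True
          have "corner C \<bullet> i \<noteq> corner P \<bullet> i" "corner C \<bullet> i \<noteq> corner N \<bullet> i"
            using sep[of C P] sep[of C N] True less.prems NL C s_nonneg[OF iB] by fastforce+
          moreover have "C \<notin> M \<or> corner N \<bullet> i \<le> corner C \<bullet> i" using N(2) by blast
          ultimately show ?thesis using C box True NL by (auto simp: M_def)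
        next
          case False
          then show ?thesis using C box \<rho>(3)[of C] by (auto simp: L_def)
        qed
      qed
      show ?case
      proof (cases "N = Q")
        case True
        then show ?thesis using PN less.prems tubeL[of P Q]
          by (intro exI[of _ "[P, Q]"]) auto
      next
        case False
        have NQ: "corner N \<bullet> i < corner Q \<bullet> i"
          using sep[of N Q] False NL less.prems s_nonneg[OF iB] by fastforce
        have "{C \<in> L. corner N \<bullet> i < corner C \<bullet> i \<and> corner C \<bullet> i \<le> corner Q \<bullet> i} \<subset> M"
          using NL N(1) by (auto simp: M_def)
        then have "card {C \<in> L. corner N \<bullet> i < corner C \<bullet> i \<and> corner C \<bullet> i \<le> corner Q \<bullet> i} < card M"
          using \<open>finite M\<close> by (rule psubset_card_mono[rotated])
        then obtain cs where cs: "length cs \<ge> 2" "hd cs = N" "last cs = Q" "distinct cs"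
          "successively (\<lambda>P Q. sees D \<C> P Q \<and> tube i P \<inter> tube i Q \<noteq> {} \<and> corner P \<bullet> i < corner Q \<bullet> i) cs"
          "set cs \<subseteq> {C \<in> L. corner N \<bullet> i \<le> corner C \<bullet> i \<and> corner C \<bullet> i \<le> corner Q \<bullet> i}"
          using less.hyps[of N] less.prems(2) NL NQ unfolding M_def by blast
        have "cs \<noteq> []" using cs by auto
        moreover have "P \<notin> set cs" using cs NL by auto
        ultimately show ?thesis using cs PN less.prems NL tubeL[of P N]
          by (intro exI[of _ "P # cs"]) (auto simp: successively_Cons)
      qed
    qed
    obtain cs where cs: "length cs \<ge> 2" "hd cs = A" "last cs = B" "distinct cs"
      "successively (\<lambda>P Q. sees D \<C> P Q \<and> tube i P \<inter> tube i Q \<noteq> {} \<and> corner P \<bullet> i < corner Q \<bullet> i) cs"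
      "set cs \<subseteq> {C \<in> L. corner A \<bullet> i \<le> corner C \<bullet> i \<and> corner C \<bullet> i \<le> corner B \<bullet> i}"
      using chain[OF ABL less] by blast
    \<comment> \<open>An inner member of the chain that belongs to \<open>\<X>\<close> would have
      blocked the original channel.\<close>
    have "set cs \<inter> \<X> \<subseteq> {A, B}"
    proof (rule subsetI, rule ccontr)
      fix C assume "C \<in> set cs \<inter> \<X>" "C \<notin> {A, B}"
      then have C: "C \<in> set cs" "C \<in> \<X>" "C \<noteq> B" "C \<noteq> A" by auto
      then have CL: "C \<in> L" "corner A \<bullet> i \<le> corner C \<bullet> i" "corner C \<bullet> i \<le> corner B \<bullet> i" using cs by auto
      have "corner A \<bullet> i + s \<bullet> i < corner C \<bullet> i" "corner C \<bullet> i < corner B \<bullet> i"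
        using sep[of A C] sep[of C B] C CL ABL s_nonneg[OF iB] by fastforce+
      moreover have "ball p r \<inter> tube i C \<noteq> {}" using CL(1) \<rho>(2) q unfolding L_def by blast
      moreover have "C \<in> boxes" using C sub box by auto
      ultimately show False using free[of C] C by auto
    qed
    then show ?thesis using i cs less tubeL[OF ABL]
      by (intro exI[of _ i] exI[of _ cs]) (auto simp: L_def)
  qed note main = this
  have ABbox: "A \<in> boxes" "B \<in> boxes" using AB sub box by auto
  have AB0: "A \<inter> B = {}" using disj AB sub by blast
  obtain i p r where *: "i \<in> D" "r > 0" "diameter (disc i p r) > 0"
    "ball p r \<subseteq> tube i A" "ball p r \<subseteq> tube i B"
    "\<And>C. C \<in> \<X> \<Longrightarrow> C \<in> boxes \<Longrightarrow> C \<noteq> A \<Longrightarrow> C \<noteq> B \<Longrightarrow> ball p r \<inter> tube i C \<noteq> {} \<Longrightarrow>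
      corner A \<bullet> i + s \<bullet> i < corner C \<bullet> i \<and> corner C \<bullet> i < corner B \<bullet> i \<or>
      corner B \<bullet> i + s \<bullet> i < corner C \<bullet> i \<and> corner C \<bullet> i < corner A \<bullet> i \<Longrightarrow> False"
    using sees_boxE[OF sees ABbox] by metis
  have iB: "i \<in> Basis" using *(1) D_Basis by auto
  have "p \<in> tube i A" "p \<in> tube i B" using * by auto
  then have "corner A \<bullet> i < corner B \<bullet> i \<or> corner B \<bullet> i < corner A \<bullet> i"
    using tube_disjoint_boxes[OF ABbox AB0 _ _ iB] s_nonneg[OF iB] by fastforce
  then consider "corner A \<bullet> i < corner B \<bullet> i" | "corner B \<bullet> i < corner A \<bullet> i" by blast
  then show ?thesis
  proof cases
    case less: 1
    from main[OF *(1-5) _ less AB(1,2)] *(6) obtain i cs where "i \<in> D" "length cs \<ge> 2" "hd cs = A" "last cs = B"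
      "successively (\<lambda>P Q. sees D \<C> P Q \<and> tube i P \<inter> tube i Q \<noteq> {} \<and> corner P \<bullet> i < corner Q \<bullet> i) cs"
      "set cs \<subseteq> \<C>" "set cs \<inter> \<X> \<subseteq> {A, B}" "distinct cs"
      by meson
    then show ?thesis by (intro that[of i cs] disjI1 conjI)
  next
    case less: 2
    from main[OF *(1-3) *(5,4) _ less AB(2,1)] *(6) obtain i cs where "i \<in> D" "length cs \<ge> 2" "hd cs = B" "last cs = A"
      "successively (\<lambda>P Q. sees D \<C> P Q \<and> tube i P \<inter> tube i Q \<noteq> {} \<and> corner P \<bullet> i < corner Q \<bullet> i) cs"
      "set cs \<subseteq> \<C>" "set cs \<inter> \<X> \<subseteq> {B, A}" "distinct cs"
      by meson
    then show ?thesis by (intro that[of i cs] disjI2 conjI) (simp_all add: insert_commute)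
  qed
qed

section \<open>Perturbed heights and the maximum norm\<close>

text \<open>Each coordinate of the corner is perturbed by \<open>\<epsilon> * real (r C)\<close>
  with an injective numbering \<open>r\<close>. Finitely many conditions are imposed, and each of
  them holds for all sufficiently small positive \<open>\<epsilon>\<close>.\<close>

lemma generic_heights:
  assumes fin: "finite \<C>" and box: "\<C> \<subseteq> boxes"
    and disj: "\<And>P Q. P \<in> \<C> \<Longrightarrow> Q \<in> \<C> \<Longrightarrow> P \<noteq> Q \<Longrightarrow> P \<inter> Q = {}"
  obtains h :: "'a \<Rightarrow> 'a set \<Rightarrow> real" where
    "\<And>i. i \<in> D \<Longrightarrow> inj_on (h i) \<C>"
    "\<And>i j P Q. i \<in> D \<Longrightarrow> j \<in> D \<Longrightarrow> P \<in> \<C> \<Longrightarrow> Q \<in> \<C> \<Longrightarrow> tube i P \<inter> tube i Q \<noteq> {} \<Longrightarrow>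
      corner P \<bullet> i < corner Q \<bullet> i \<Longrightarrow> \<bar>h j P - h j Q\<bar> \<le> h i Q - h i P"
proof -
  obtain r :: "'a set \<Rightarrow> nat" where r: "inj_on r \<C>"
    using finite_imp_inj_to_nat_seg[OF fin] by blast
  define h where "h \<epsilon> i C = corner C \<bullet> i + \<epsilon> * real (r C)" for \<epsilon> :: real and i C
  have finD: "finite D" using D_Basis finite_Basis finite_subset by blast
  have lim: "((\<lambda>\<epsilon>. h \<epsilon> i P - h \<epsilon> i Q) \<longlongrightarrow> corner P \<bullet> i - corner Q \<bullet> i) (at_right 0)" for i P Q
  proof -
    have "((\<lambda>\<epsilon>. h \<epsilon> i P - h \<epsilon> i Q) \<longlongrightarrow>
        (corner P \<bullet> i + 0 * real (r P)) - (corner Q \<bullet> i + 0 * real (r Q))) (at_right 0)"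
      unfolding h_def by (intro tendsto_intros)
    then show ?thesis by simp
  qed
  have inj: "\<forall>\<^sub>F \<epsilon> in at_right 0. P \<noteq> Q \<longrightarrow> h \<epsilon> i P \<noteq> h \<epsilon> i Q"
    if "P \<in> \<C>" "Q \<in> \<C>" for i P Q
  \<comment> \<open>Equal coordinates are separated by the numbering \<open>r\<close>; distinct ones
    stay distinct in the limit.\<close>
  proof (cases "corner P \<bullet> i = corner Q \<bullet> i")
    case True
    show ?thesis
      using eventually_at_right_less[of "0::real"]
    proof eventually_elim
      case (elim \<epsilon>)
      then show ?case using True inj_onD[OF r _ that] by (auto simp: h_def)
    qed
  next
    case False
    then have "\<forall>\<^sub>F \<epsilon> in at_right 0. h \<epsilon> i P - h \<epsilon> i Q \<noteq> 0"
      using lim[of i P Q] by (intro tendsto_imp_eventually_ne) auto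
    then show ?thesis by eventually_elim auto
  qed
  have dom: "\<forall>\<^sub>F \<epsilon> in at_right 0. tube i P \<inter> tube i Q \<noteq> {} \<longrightarrow> corner P \<bullet> i < corner Q \<bullet> i \<longrightarrow>
      \<bar>h \<epsilon> j P - h \<epsilon> j Q\<bar> \<le> h \<epsilon> i Q - h \<epsilon> i P"
    if PQ: "P \<in> \<C>" "Q \<in> \<C>" and ij: "i \<in> D" "j \<in> D" for i j P Q
  proof (cases "tube i P \<inter> tube i Q \<noteq> {} \<and> corner P \<bullet> i < corner Q \<bullet> i")
    case True
    then obtain x where x: "x \<in> tube i P" "x \<in> tube i Q" by auto
    have B: "i \<in> Basis" "j \<in> Basis" using ij D_Basis by auto
    show ?thesis
    proof (cases "j = i")
      case True': True
      have "\<forall>\<^sub>F \<epsilon> in at_right 0. h \<epsilon> i Q - h \<epsilon> i P > 0"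
        using lim[of i Q P] True by (intro order_tendstoD) auto
      then show ?thesis by eventually_elim (auto simp: True')
    next
      case False
      have "P \<noteq> Q" using True by auto
      then have "corner P \<bullet> i + s \<bullet> i < corner Q \<bullet> i \<or> corner Q \<bullet> i + s \<bullet> i < corner P \<bullet> i"
        using tube_disjoint_boxes[OF _ _ _ x B(1)] PQ box disj by blast
      \<comment> \<open>Disjoint boxes with a common tube point differ by more than a side along
        \<open>i\<close>, but by at most a side along \<open>j\<close>. Both sides have the same
        length by \<open>s_eq\<close>, so the inequality is strict and survives the
        perturbation.\<close>
      then have "s \<bullet> i < corner Q \<bullet> i - corner P \<bullet> i" using True s_nonneg[OF B(1)] by auto
      moreover have "\<bar>corner P \<bullet> j - corner Q \<bullet> j\<bar> \<le> s \<bullet> j"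
        using tube_corner_diff[OF x B(2) False] .
      ultimately have less: "(corner Q \<bullet> i - corner P \<bullet> i) - \<bar>corner P \<bullet> j - corner Q \<bullet> j\<bar> > 0"
        using s_eq[OF ij] by auto
      have "\<forall>\<^sub>F \<epsilon> in at_right 0. (h \<epsilon> i Q - h \<epsilon> i P) - \<bar>h \<epsilon> j P - h \<epsilon> j Q\<bar> > 0"
        by (rule order_tendstoD(1)[OF tendsto_diff[OF lim tendsto_rabs[OF lim]] less])
      then show ?thesis by eventually_elim auto
    qed
  next
    case False
    then show ?thesis by (intro always_eventually) blast
  qed
  have "\<forall>\<^sub>F \<epsilon> in at_right 0. (\<forall>i\<in>D. \<forall>P\<in>\<C>. \<forall>Q\<in>\<C>. P \<noteq> Q \<longrightarrow> h \<epsilon> i P \<noteq> h \<epsilon> i Q) \<and>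
      (\<forall>i\<in>D. \<forall>j\<in>D. \<forall>P\<in>\<C>. \<forall>Q\<in>\<C>. tube i P \<inter> tube i Q \<noteq> {} \<longrightarrow> corner P \<bullet> i < corner Q \<bullet> i \<longrightarrow>
        \<bar>h \<epsilon> j P - h \<epsilon> j Q\<bar> \<le> h \<epsilon> i Q - h \<epsilon> i P)"
    by (intro eventually_conj eventually_ball_finite ballI fin finD inj dom)
  from eventually_happens'[OF trivial_limit_at_right_real this] obtain \<epsilon> where
    \<epsilon>: "\<forall>i\<in>D. \<forall>P\<in>\<C>. \<forall>Q\<in>\<C>. P \<noteq> Q \<longrightarrow> h \<epsilon> i P \<noteq> h \<epsilon> i Q"
      "\<forall>i\<in>D. \<forall>j\<in>D. \<forall>P\<in>\<C>. \<forall>Q\<in>\<C>. tube i P \<inter> tube i Q \<noteq> {} \<longrightarrow> corner P \<bullet> i < corner Q \<bullet> i \<longrightarrow>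
        \<bar>h \<epsilon> j P - h \<epsilon> j Q\<bar> \<le> h \<epsilon> i Q - h \<epsilon> i P"
    by (elim exE conjE)
  show ?thesis
  proof (rule that[of "h \<epsilon>"])
    show "inj_on (h \<epsilon> i) \<C>" if "i \<in> D" for i using \<epsilon>(1) that by (meson inj_onI)
  qed (use \<epsilon>(2) in blast)
qed

text \<open>
  As \<open>h\<close> is 1-Lipschitz for \<open>\<delta>\<close> and increases by exactly \<open>\<delta>\<close> in every step, the chain is a
  \<open>\<delta>\<close>-geodesic.
\<close>

definition sight_chain ::
  "'a set set \<Rightarrow> ('a set \<Rightarrow> 'a set \<Rightarrow> real) \<Rightarrow> 'a set set \<Rightarrow> 'a set \<Rightarrow> 'a set \<Rightarrow> ('a set \<Rightarrow> real) \<Rightarrow> 'a set list \<Rightarrow> bool" where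
  "sight_chain \<C> \<delta> \<X> A B h cs \<longleftrightarrow>
    inj_on h \<C> \<and> (\<forall>P\<in>\<C>. \<forall>Q\<in>\<C>. \<bar>h P - h Q\<bar> \<le> \<delta> P Q) \<and> length cs \<ge> 2 \<and>
    (hd cs = A \<and> last cs = B \<or> hd cs = B \<and> last cs = A) \<and> set cs \<subseteq> \<C> \<and> set cs \<inter> \<X> \<subseteq> {A, B} \<and>
    distinct cs \<and> successively (\<lambda>P Q. P \<noteq> Q \<and> sees D \<C> P Q \<and> \<delta> P Q = h Q - h P) cs"

text \<open>Collects what the tree argument uses about distances: symmetry, positivity, and a
  geodesic chain behind every sighting in a subfamily. The condition \<open>D \<noteq> {}\<close> is
  there because the distance will be a maximum over \<open>D\<close>.\<close>

definition sight_metric :: "'a set set \<Rightarrow> ('a set \<Rightarrow> 'a set \<Rightarrow> real) \<Rightarrow> bool" where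
  "sight_metric \<C> \<delta> \<longleftrightarrow> (\<forall>P Q. \<delta> P Q = \<delta> Q P) \<and>
    (\<forall>P\<in>\<C>. \<forall>Q\<in>\<C>. P \<noteq> Q \<longrightarrow> D \<noteq> {} \<longrightarrow> \<delta> P Q > 0) \<and>
    (\<forall>\<X> A B. \<X> \<subseteq> \<C> \<longrightarrow> A \<in> \<X> \<longrightarrow> B \<in> \<X> \<longrightarrow> A \<noteq> B \<longrightarrow> sees D \<X> A B \<longrightarrow>
      (\<exists>h cs. sight_chain \<C> \<delta> \<X> A B h cs))"

lemma sight_metricD:
  assumes "sight_metric \<C> \<delta>"
  shows "\<delta> P Q = \<delta> Q P"
    and "P \<in> \<C> \<Longrightarrow> Q \<in> \<C> \<Longrightarrow> P \<noteq> Q \<Longrightarrow> D \<noteq> {} \<Longrightarrow> \<delta> P Q > 0"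
    and "\<X> \<subseteq> \<C> \<Longrightarrow> A \<in> \<X> \<Longrightarrow> B \<in> \<X> \<Longrightarrow> A \<noteq> B \<Longrightarrow> sees D \<X> A B \<Longrightarrow>
      \<exists>h cs. sight_chain \<C> \<delta> \<X> A B h cs"
  using assms unfolding sight_metric_def by simp_all

lemma sight_metric_exists:
  assumes fin: "finite \<C>" and box: "\<C> \<subseteq> boxes"
    and disj: "\<And>P Q. P \<in> \<C> \<Longrightarrow> Q \<in> \<C> \<Longrightarrow> P \<noteq> Q \<Longrightarrow> P \<inter> Q = {}"
  shows "\<exists>\<delta>. sight_metric \<C> \<delta>"
proof -
  obtain h :: "'a \<Rightarrow> 'a set \<Rightarrow> real" where h:
    "\<And>i. i \<in> D \<Longrightarrow> inj_on (h i) \<C>"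
    "\<And>i j P Q. i \<in> D \<Longrightarrow> j \<in> D \<Longrightarrow> P \<in> \<C> \<Longrightarrow> Q \<in> \<C> \<Longrightarrow> tube i P \<inter> tube i Q \<noteq> {} \<Longrightarrow>
      corner P \<bullet> i < corner Q \<bullet> i \<Longrightarrow> \<bar>h j P - h j Q\<bar> \<le> h i Q - h i P"
    using generic_heights[OF fin box disj] by metis
  have finD: "finite D" using D_Basis finite_Basis finite_subset by blast
  \<comment> \<open>The maximum norm, taken only over the coordinates in \<open>D\<close>, of the
    difference of the perturbed positions.\<close>
  define \<delta> where "\<delta> P Q = Max ((\<lambda>i. \<bar>h i P - h i Q\<bar>) ` D)" for P Q
  have le: "\<bar>h i P - h i Q\<bar> \<le> \<delta> P Q" if "i \<in> D" for i P Q
    unfolding \<delta>_def using that finD by (intro Max_ge) auto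
  have "sight_metric \<C> \<delta>"
    unfolding sight_metric_def
  proof (intro conjI ballI allI impI)
    show "\<delta> P Q = \<delta> Q P" for P Q unfolding \<delta>_def by (simp add: abs_minus_commute)
    show "\<delta> P Q > 0" if PQ: "P \<in> \<C>" "Q \<in> \<C>" "P \<noteq> Q" and "D \<noteq> {}" for P Q
    proof -
      obtain i where i: "i \<in> D" using \<open>D \<noteq> {}\<close> by auto
      then have "h i P \<noteq> h i Q" using h(1) PQ by (auto dest: inj_onD)
      then show ?thesis using le[OF i, of P Q] by auto
    qed
  next
    fix \<X> A B assume X: "\<X> \<subseteq> \<C>" "A \<in> \<X>" "B \<in> \<X>" "A \<noteq> B" "sees D \<X> A B"
    obtain i cs where i: "i \<in> D" and cs: "length cs \<ge> 2" "hd cs = A \<and> last cs = B \<or> hd cs = B \<and> last cs = A"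
      "successively (\<lambda>P Q. sees D \<C> P Q \<and> tube i P \<inter> tube i Q \<noteq> {} \<and> corner P \<bullet> i < corner Q \<bullet> i) cs"
      "set cs \<subseteq> \<C>" "set cs \<inter> \<X> \<subseteq> {A, B}" "distinct cs"
      by (rule sees_chain[OF fin box disj X])
    \<comment> \<open>On a channel along \<open>i\<close> the increment of \<open>h i\<close>
      dominates those of all other coordinates, so the maximum is attained at
      \<open>i\<close>.\<close>
    have eq: "\<delta> P Q = h i Q - h i P"
      if PQ: "P \<in> set cs" "Q \<in> set cs" "tube i P \<inter> tube i Q \<noteq> {}" "corner P \<bullet> i < corner Q \<bullet> i" for P Q
    proof (rule antisym)
      have "\<bar>h j P - h j Q\<bar> \<le> h i Q - h i P" if "j \<in> D" for j
        using h(2)[OF i \<open>j \<in> D\<close> _ _ PQ(3,4)] PQ(1,2) cs(4) by blast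
      then show "\<delta> P Q \<le> h i Q - h i P"
        unfolding \<delta>_def using finD i by (intro Max.boundedI) auto
      show "h i Q - h i P \<le> \<delta> P Q" using le[OF i, of P Q] by simp
    qed
    have succ: "successively (\<lambda>P Q. P \<noteq> Q \<and> sees D \<C> P Q \<and> \<delta> P Q = h i Q - h i P) cs"
      by (rule successively_mono[OF cs(3)]) (use eq in blast)
    show "\<exists>h cs. sight_chain \<C> \<delta> \<X> A B h cs"
      unfolding sight_chain_def
    proof (intro exI conjI ballI)
      show "inj_on (h i) \<C>" using h(1)[OF i] .
      show "\<bar>h i P - h i Q\<bar> \<le> \<delta> P Q" for P Q using le[OF i] .
    qed (fact cs(1,2,4,5,6) succ)+
  qed
  then show ?thesis by blast
qed

end

section \<open>Superposing representations\<close>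

lemma visibility_repD:
  assumes "visibility_rep K D G f"
  shows "v \<in> verts G \<Longrightarrow> f v \<subseteq> K" "v \<in> verts G \<Longrightarrow> finite (f v)" "v \<in> verts G \<Longrightarrow> f v \<noteq> {}"
    and "u \<in> verts G \<Longrightarrow> v \<in> verts G \<Longrightarrow> A \<in> f u \<Longrightarrow> B \<in> f v \<Longrightarrow> (u, A) \<noteq> (v, B) \<Longrightarrow> A \<inter> B = {}"
    and "u \<in> verts G \<Longrightarrow> v \<in> verts G \<Longrightarrow> u \<noteq> v \<Longrightarrow>
      {u, v} \<in> edges G \<longleftrightarrow> (\<exists>A\<in>f u. \<exists>B\<in>f v. sees D (\<Union>(f ` verts G)) A B)"
    and "v \<in> verts G \<Longrightarrow> A \<in> f v \<Longrightarrow> B \<in> f v \<Longrightarrow> A \<noteq> B \<Longrightarrow> \<not> sees D (\<Union>(f ` verts G)) A B"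
  using assms unfolding visibility_rep_def by simp_all

section \<open>Disjoint copies along the diagonal\<close>

context box_model
begin

text \<open>Separation in every coordinate, not just in one: as soon as there is a second axis, no
  tubes along a common axis meet. A large shift along the diagonal achieves this.\<close>

definition apart :: "'a set \<Rightarrow> 'a set \<Rightarrow> bool" where
  "apart P Q \<longleftrightarrow> (\<forall>b\<in>Basis. corner P \<bullet> b + s \<bullet> b < corner Q \<bullet> b \<or> corner Q \<bullet> b + s \<bullet> b < corner P \<bullet> b)"

lemma apart_tube:
  assumes "apart P Q" "x \<in> tube i P" "b \<in> Basis" "b \<noteq> i"
  shows "x \<notin> tube i Q"
proof
  assume "x \<in> tube i Q"
  then have "corner P \<bullet> b \<le> x \<bullet> b" "x \<bullet> b \<le> corner P \<bullet> b + s \<bullet> b"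
    "corner Q \<bullet> b \<le> x \<bullet> b" "x \<bullet> b \<le> corner Q \<bullet> b + s \<bullet> b"
    using assms by (auto simp: tube_def)
  then show False using assms(1,3) unfolding apart_def by fastforce
qed

lemma apart_disjoint:
  assumes "P \<in> boxes" "Q \<in> boxes" "apart P Q"
  shows "P \<inter> Q = {}"
proof (rule ccontr)
  assume "P \<inter> Q \<noteq> {}"
  then obtain x where "x \<in> P" "x \<in> Q" by blast
  moreover obtain b :: 'a where b: "b \<in> Basis" using nonempty_Basis by blast
  ultimately have "corner P \<bullet> b \<le> x \<bullet> b" "x \<bullet> b \<le> corner P \<bullet> b + s \<bullet> b"
    "corner Q \<bullet> b \<le> x \<bullet> b" "x \<bullet> b \<le> corner Q \<bullet> b + s \<bullet> b"
    using mem_box_iff_tube[OF _ b] assms by blast+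
  then show False using assms(3) b unfolding apart_def by fastforce
qed

text \<open>A channel of positive diameter guarantees an axis other than its own, and in that
  coordinate the two tubes are disjoint.\<close>

lemma apart_not_sees:
  assumes "A \<in> boxes" "B \<in> boxes" "apart A B"
  shows "\<not> sees D \<C> A B"
proof
  assume "sees D \<C> A B"
  then obtain i p r where *: "r > 0" "diameter (disc i p r) > 0" "ball p r \<subseteq> tube i A" "ball p r \<subseteq> tube i B"
    using sees_boxE[OF _ assms(1,2)] by metis
  then have "p \<in> tube i A" "p \<in> tube i B" by auto
  then show False using apart_tube[OF assms(3)] disc_other_axis[OF *(2)] by blast
qed

text \<open>The channel stays within the tube of \<open>A\<close>, which the additional boxes do not
  meet.\<close>

lemma sees_if_others_apart:
  assumes "sees D \<C> A B" "A \<in> boxes" "\<And>C. C \<in> \<C>' \<Longrightarrow> C \<notin> \<C> \<Longrightarrow> C \<in> boxes \<and> apart A C"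
  shows "sees D \<C>' A B"
proof -
  obtain i p r l where *: "i \<in> D" "diameter (disc i p r) > 0" "disc i p r \<subseteq> A"
    "(\<lambda>x. x + l *\<^sub>R i) ` disc i p r \<subseteq> B" "\<forall>C\<in>\<C> - {A, B}. cylinder i p r l \<inter> C = {}"
    using assms(1) by (auto simp: sees_def)
  have i: "i \<in> Basis" using *(1) D_Basis by auto
  have "cylinder i p r l \<inter> C = {}" if C: "C \<in> \<C>' - {A, B}" for C
  proof (cases "C \<in> \<C>")
    case False
    have "C \<in> boxes" "apart A C" using assms(3) C False by blast+
    show ?thesis
    proof (rule ccontr)
      assume "cylinder i p r l \<inter> C \<noteq> {}"
      then obtain x y where x: "x \<in> A" "y \<in> closed_segment x (x + l *\<^sub>R i)" "y \<in> C"
        using *(3) by (auto simp: cylinder_def)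
      then obtain u where "y = (1 - u) *\<^sub>R x + u *\<^sub>R (x + l *\<^sub>R i)"
        by (auto simp: closed_segment_def)
      then have "y = x + (u * l) *\<^sub>R i" by (simp add: algebra_simps)
      then have "y \<in> tube i A" using x(1) mem_box_iff_tube[OF assms(2) i] tube_shift[OF i] by blast
      moreover have "y \<in> tube i C" using x(3) mem_box_iff_tube[OF \<open>C \<in> boxes\<close> i] by blast
      ultimately show False using apart_tube[OF \<open>apart A C\<close>] disc_other_axis[OF *(2)] by blast
    qed
  qed (use *(5) that in blast)
  then show ?thesis unfolding sees_def using *(1-4) by blast
qed

text \<open>The graphs may share vertices, and the bound on \<open>card (F v)\<close> adds up the
  boxes of \<open>v\<close> over the graphs containing it. The lemma serves both for the disjoint
  trees of one forest and for the overlapping forests of a decomposition.\<close>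

lemma visibility_rep_union:
  fixes G :: "'i \<Rightarrow> 'v graph"
  assumes I: "finite I" and simple: "\<And>m. m \<in> I \<Longrightarrow> simple_graph (G m)"
    and rep: "\<And>m. m \<in> I \<Longrightarrow> visibility_rep boxes D (G m) (f m)"
  obtains F where "visibility_rep boxes D (graph_union (G ` I)) F"
    "\<And>v. card (F v) \<le> (\<Sum>m\<in>{m\<in>I. v \<in> verts (G m)}. card (f m v))"
proof -
  define \<C> where "\<C> m = \<Union>(f m ` verts (G m))" for m
  have fin: "finite (f m v)" if "m \<in> I" "v \<in> verts (G m)" for m v
    using visibility_repD(2)[OF rep[OF that(1)] that(2)] .
  have box: "C \<in> boxes" if "m \<in> I" "C \<in> \<C> m" for m C
    using visibility_repD(1)[OF rep[OF that(1)]] that(2) by (auto simp: \<C>_def)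
  have "finite (\<Union>m\<in>I. \<C> m)"
    using I simple fin by (auto simp: \<C>_def simple_graph_def)
  then have "bounded (corner ` (\<Union>m\<in>I. \<C> m))" by (intro finite_imp_bounded finite_imageI)
  then obtain R where R: "\<And>m C. m \<in> I \<Longrightarrow> C \<in> \<C> m \<Longrightarrow> norm (corner C) \<le> R"
    unfolding bounded_iff by blast
  have R_b: "\<bar>corner C \<bullet> b\<bar> \<le> R" if "m \<in> I" "C \<in> \<C> m" "b \<in> Basis" for m C b
    using Basis_le_norm[OF that(3)] R[OF that(1,2)] by (rule order_trans)
  obtain r :: "'i \<Rightarrow> nat" where r: "inj_on r I"
    using finite_imp_inj_to_nat_seg[OF I] by blast
  \<comment> \<open>Corner coordinates vary by at most \<open>2 * R\<close> and the sum of all sides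
    bounds each side; the extra 1 makes the separation strict.\<close>
  define M where "M = 2 * R + (\<Sum>b\<in>Basis. s \<bullet> b) + 1"
  have M: "M > 2 * R + s \<bullet> b" if "b \<in> Basis" for b
    using member_le_sum[of b Basis "\<lambda>b. s \<bullet> b"] that s_nonneg by (auto simp: M_def)
  define z where "z m = (real (r m) * M) *\<^sub>R (One :: 'a)" for m
  have z: "z m \<bullet> b = real (r m) * M" if "b \<in> Basis" for m b using that by (simp add: z_def)
  define \<tau> where "\<tau> m = (`) ((+) (z m))" for m
  have \<tau>_box: "\<tau> m A \<in> boxes" "corner (\<tau> m A) = z m + corner A" if "m \<in> I" "A \<in> \<C> m" for m A
    unfolding \<tau>_def using translate_box[OF box[OF that]] by auto
  have apart_less: "corner (\<tau> m A) \<bullet> b + s \<bullet> b < corner (\<tau> m' B) \<bullet> b"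
    if "m \<in> I" "m' \<in> I" "r m < r m'" "A \<in> \<C> m" "B \<in> \<C> m'" "b \<in> Basis" for m m' A B b
  proof -
    have A: "\<bar>corner A \<bullet> b\<bar> \<le> R" and B: "\<bar>corner B \<bullet> b\<bar> \<le> R" using R_b that by blast+
    then have "M > 0" using M[OF \<open>b \<in> Basis\<close>] s_nonneg[OF \<open>b \<in> Basis\<close>] by linarith
    then have "(real (r m) + 1) * M \<le> real (r m') * M" using that(3) by (intro mult_right_mono) auto
    then have "real (r m) * M + M \<le> real (r m') * M" by (simp add: algebra_simps)
    then show ?thesis using A B M[OF \<open>b \<in> Basis\<close>] that by (simp add: \<tau>_box z inner_simps)
  qed
  have apart: "apart (\<tau> m A) (\<tau> m' B)"
    if "m \<in> I" "m' \<in> I" "m \<noteq> m'" "A \<in> \<C> m" "B \<in> \<C> m'" for m m' A B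
  proof -
    have "r m < r m' \<or> r m' < r m" using inj_onD[OF r _ that(1,2)] that(3) by fastforce
    then show ?thesis unfolding apart_def using apart_less that by blast
  qed
  \<comment> \<open>Only graphs containing \<open>v\<close> contribute, since nothing is known about
    \<open>f m v\<close> otherwise.\<close>
  define F where "F v = (\<Union>m\<in>{m\<in>I. v \<in> verts (G m)}. \<tau> m ` f m v)" for v
  let ?H = "graph_union (G ` I)"
  have verts: "verts ?H = (\<Union>m\<in>I. verts (G m))" and edges: "edges ?H = (\<Union>m\<in>I. edges (G m))"
    by (auto simp: graph_union_def)
  have FE: "\<exists>m A0. m \<in> I \<and> v \<in> verts (G m) \<and> A0 \<in> f m v \<and> A0 \<in> \<C> m \<and> A = \<tau> m A0" if "A \<in> F v" for A v
    using that by (auto simp: F_def \<C>_def)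
  have \<U>: "\<Union>(F ` verts ?H) = (\<Union>m\<in>I. \<tau> m ` \<C> m)"
    unfolding verts F_def \<C>_def by auto
  \<comment> \<open>For one direction, dropping the other copies only removes obstacles, and the
    remaining copy is translated back; for the other, the other copies are apart from
    \<open>\<tau> m A\<close> and do not block.\<close>
  have sees_iff: "sees D (\<Union>(F ` verts ?H)) (\<tau> m A) (\<tau> m B) \<longleftrightarrow> sees D (\<C> m) A B"
    if m: "m \<in> I" and AB: "A \<in> \<C> m" "B \<in> \<C> m" for m A B
  proof
    assume "sees D (\<Union>(F ` verts ?H)) (\<tau> m A) (\<tau> m B)"
    then have "sees D (\<tau> m ` \<C> m) (\<tau> m A) (\<tau> m B)"
      by (rule sees_mono) (use m in \<open>auto simp: \<U>\<close>)
    from sees_translate[OF this, of "- z m"] show "sees D (\<C> m) A B"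
      by (simp add: \<tau>_def image_image)
  next
    assume "sees D (\<C> m) A B"
    then have "sees D (\<tau> m ` \<C> m) (\<tau> m A) (\<tau> m B)" unfolding \<tau>_def by (rule sees_translate)
    then show "sees D (\<Union>(F ` verts ?H)) (\<tau> m A) (\<tau> m B)"
    proof (rule sees_if_others_apart)
      show "\<tau> m A \<in> boxes" using \<tau>_box m AB by blast
      fix C assume "C \<in> \<Union>(F ` verts ?H)" "C \<notin> \<tau> m ` \<C> m"
      then obtain m' C0 where "m' \<in> I" "C0 \<in> \<C> m'" "C = \<tau> m' C0" "m' \<noteq> m" unfolding \<U> by auto
      then show "C \<in> boxes \<and> apart (\<tau> m A) C" using \<tau>_box apart m AB by blast
    qed
  qed
  have sees_same: "m = m'" if "m \<in> I" "m' \<in> I" "A \<in> \<C> m" "B \<in> \<C> m'"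
    "sees D (\<Union>(F ` verts ?H)) (\<tau> m A) (\<tau> m' B)" for m m' A B
    using apart_not_sees[of "\<tau> m A" "\<tau> m' B"] apart[of m m' A B] \<tau>_box that by blast
  have "visibility_rep boxes D ?H F"
    unfolding visibility_rep_def
  proof (intro conjI ballI impI)
    fix v assume v: "v \<in> verts ?H"
    show "F v \<subseteq> boxes" using FE \<tau>_box by blast
    show "finite (F v)" unfolding F_def using I fin by auto
    obtain m where m: "m \<in> I" "v \<in> verts (G m)" using v unfolding verts by blast
    then have "f m v \<noteq> {}" using visibility_repD(3)[OF rep] by blast
    then show "F v \<noteq> {}" using m unfolding F_def by blast
  next
    fix u v A B assume "u \<in> verts ?H" "v \<in> verts ?H" and AB: "A \<in> F u" "B \<in> F v" "(u, A) \<noteq> (v, B)"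
    obtain m A0 where A: "m \<in> I" "u \<in> verts (G m)" "A0 \<in> f m u" "A0 \<in> \<C> m" "A = \<tau> m A0"
      using FE[OF AB(1)] by blast
    obtain m' B0 where B: "m' \<in> I" "v \<in> verts (G m')" "B0 \<in> f m' v" "B0 \<in> \<C> m'" "B = \<tau> m' B0"
      using FE[OF AB(2)] by blast
    show "A \<inter> B = {}"
    proof (cases "m = m'")
      case True
      then have "(u, A0) \<noteq> (v, B0)" using AB(3) A B by auto
      then have "A0 \<inter> B0 = {}" using visibility_repD(4)[OF rep[OF A(1)]] A B True by blast
      then show ?thesis unfolding A(5) B(5) True \<tau>_def by auto
    next
      case False
      then show ?thesis using apart_disjoint apart \<tau>_box A B by blast
    qed
  next
    fix u v assume "u \<in> verts ?H" "v \<in> verts ?H" "u \<noteq> v"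
    show "{u, v} \<in> edges ?H \<longleftrightarrow> (\<exists>A\<in>F u. \<exists>B\<in>F v. sees D (\<Union>(F ` verts ?H)) A B)"
    proof
      assume "{u, v} \<in> edges ?H"
      then obtain m where m: "m \<in> I" "{u, v} \<in> edges (G m)" unfolding edges by blast
      have uv: "u \<in> verts (G m)" "v \<in> verts (G m)" using simple_graph_edgeD[OF simple[OF m(1)] m(2)] by auto
      then obtain A B where AB: "A \<in> f m u" "B \<in> f m v" "sees D (\<C> m) A B"
        using visibility_repD(5)[OF rep[OF m(1)] uv \<open>u \<noteq> v\<close>] m(2) unfolding \<C>_def by blast
      have "A \<in> \<C> m" "B \<in> \<C> m" using AB uv by (auto simp: \<C>_def)
      then have "sees D (\<Union>(F ` verts ?H)) (\<tau> m A) (\<tau> m B)" using sees_iff m AB by blast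
      moreover have "\<tau> m A \<in> F u" "\<tau> m B \<in> F v" using AB uv m by (auto simp: F_def)
      ultimately show "\<exists>A\<in>F u. \<exists>B\<in>F v. sees D (\<Union>(F ` verts ?H)) A B" by blast
    next
      assume "\<exists>A\<in>F u. \<exists>B\<in>F v. sees D (\<Union>(F ` verts ?H)) A B"
      then obtain A B where AB: "A \<in> F u" "B \<in> F v" "sees D (\<Union>(F ` verts ?H)) A B" by blast
      obtain m A0 where A: "m \<in> I" "u \<in> verts (G m)" "A0 \<in> f m u" "A0 \<in> \<C> m" "A = \<tau> m A0"
        using FE[OF AB(1)] by blast
      obtain m' B0 where B: "m' \<in> I" "v \<in> verts (G m')" "B0 \<in> f m' v" "B0 \<in> \<C> m'" "B = \<tau> m' B0"
        using FE[OF AB(2)] by blast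
      have [simp]: "m' = m" using sees_same A B AB(3) by metis
      have "sees D (\<C> m) A0 B0" using sees_iff[of m A0 B0] A B AB(3) by simp
      then have "{u, v} \<in> edges (G m)"
        using visibility_repD(5)[OF rep[OF A(1)] A(2) _ \<open>u \<noteq> v\<close>] A(3) B(2,3) by (auto simp: \<C>_def)
      then show "{u, v} \<in> edges ?H" unfolding edges using A(1) by blast
    qed
  next
    fix v A B assume AB: "v \<in> verts ?H" "A \<in> F v" "B \<in> F v" "A \<noteq> B"
    obtain m A0 where A: "m \<in> I" "v \<in> verts (G m)" "A0 \<in> f m v" "A0 \<in> \<C> m" "A = \<tau> m A0"
      using FE[OF AB(2)] by blast
    obtain m' B0 where B: "m' \<in> I" "v \<in> verts (G m')" "B0 \<in> f m' v" "B0 \<in> \<C> m'" "B = \<tau> m' B0"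
      using FE[OF AB(3)] by blast
    show "\<not> sees D (\<Union>(F ` verts ?H)) A B"
    proof
      assume sees: "sees D (\<Union>(F ` verts ?H)) A B"
      have [simp]: "m' = m" using sees_same A B sees by metis
      have "sees D (\<C> m) A0 B0" using sees_iff[of m A0 B0] A B sees by simp
      moreover have "A0 \<noteq> B0" using AB(4) A B by auto
      ultimately show False
        using visibility_repD(6)[OF rep[OF A(1)] A(2,3)] B(3) by (simp add: \<C>_def)
    qed
  qed
  moreover have "card (F v) \<le> (\<Sum>m\<in>{m\<in>I. v \<in> verts (G m)}. card (f m v))" for v
  proof -
    have "card (F v) \<le> (\<Sum>m\<in>{m\<in>I. v \<in> verts (G m)}. card (\<tau> m ` f m v))"
      unfolding F_def using I by (intro card_UN_le) auto
    also have "\<dots> \<le> (\<Sum>m\<in>{m\<in>I. v \<in> verts (G m)}. card (f m v))"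
      using fin by (intro sum_mono card_image_le) auto
    finally show ?thesis .
  qed
  ultimately show ?thesis using that by blast
qed

text \<open>The trees are disjoint, so at most one of them contributes a box to a given
  vertex.\<close>

lemma visibility_forest_rep:
  assumes "visibility_forest boxes D H"
  obtains f where "visibility_rep boxes D H f" "\<And>v. v \<in> verts H \<Longrightarrow> card (f v) \<le> 1"
proof -
  obtain \<T> where \<T>: "finite \<T>" "\<forall>S\<in>\<T>. visibility_tree boxes D S"
    "\<forall>S\<in>\<T>. \<forall>S'\<in>\<T>. S \<noteq> S' \<longrightarrow> verts S \<inter> verts S' = {}" "H = graph_union \<T>"
    using assms unfolding visibility_forest_def by (elim exE conjE)
  have "\<forall>S\<in>\<T>. \<exists>f. visibility_rep boxes D S f \<and> (\<forall>v\<in>verts S. card (f v) = 1)"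
    using \<T>(2) by (auto simp: visibility_tree_def visibility_graph_def)
  then obtain f where f: "\<And>S. S \<in> \<T> \<Longrightarrow> visibility_rep boxes D S (f S)"
    "\<And>S v. S \<in> \<T> \<Longrightarrow> v \<in> verts S \<Longrightarrow> card (f S v) = 1"
    by metis
  have simple: "simple_graph S" if "S \<in> \<T>" for S
    using \<T>(2) that by (simp add: visibility_tree_def tree_def)
  obtain F where F: "visibility_rep boxes D (graph_union ((\<lambda>S. S) ` \<T>)) F"
    "\<And>v. card (F v) \<le> (\<Sum>S\<in>{S\<in>\<T>. v \<in> verts S}. card (f S v))"
    by (rule visibility_rep_union[OF \<T>(1) simple f(1)]) (assumption | rule that)+
  have "card (F v) \<le> 1" for v
  proof -
    have "card {S\<in>\<T>. v \<in> verts S} \<le> 1"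
      using \<T>(1,3) by (subst One_nat_def, subst card_le_Suc0_iff_eq) (simp, blast)
    moreover have "(\<Sum>S\<in>{S\<in>\<T>. v \<in> verts S}. card (f S v)) = card {S\<in>\<T>. v \<in> verts S}"
      using f(2) by simp
    ultimately show ?thesis using F(2)[of v] by linarith
  qed
  then show ?thesis using that F(1) \<T>(4) by simp
qed

text \<open>The bound of the visibility number by the arboricity: superposing the forests gives a
  vertex at most one box per forest.\<close>

lemma forests_imp_rep:
  assumes "\<And>j. j < k \<Longrightarrow> subgraph (H j) T" "\<And>j. j < k \<Longrightarrow> visibility_forest boxes D (H j)"
    and "T = graph_union (H ` {..<k})"
  shows "\<exists>f. visibility_rep boxes D T f \<and> (\<forall>v\<in>verts T. card (f v) \<le> k)"
proof -
  have "\<forall>j<k. \<exists>f. visibility_rep boxes D (H j) f \<and> (\<forall>v\<in>verts (H j). card (f v) \<le> 1)"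
    using visibility_forest_rep assms(2) by metis
  then obtain f where f: "\<And>j. j < k \<Longrightarrow> visibility_rep boxes D (H j) (f j)"
    "\<And>j v. j < k \<Longrightarrow> v \<in> verts (H j) \<Longrightarrow> card (f j v) \<le> 1"
    by metis
  have simple: "\<And>j. j < k \<Longrightarrow> simple_graph (H j)" using assms(1) by (auto simp: subgraph_def)
  obtain F where F: "visibility_rep boxes D (graph_union (H ` {..<k})) F"
    "\<And>v. card (F v) \<le> (\<Sum>j\<in>{j\<in>{..<k}. v \<in> verts (H j)}. card (f j v))"
    by (rule visibility_rep_union[of "{..<k}" H f]) (use simple f(1) in auto)
  have "card (F v) \<le> k" for v
  proof -
    let ?J = "{j\<in>{..<k}. v \<in> verts (H j)}"
    have "(\<Sum>j\<in>?J. card (f j v)) \<le> (\<Sum>j\<in>?J. 1)"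
      using f(2) by (intro sum_mono) auto
    also have "\<dots> = card ?J" by simp
    also have "\<dots> \<le> card {..<k}" by (intro card_mono) auto
    finally show ?thesis using F(2)[of v] by simp
  qed
  then show ?thesis using F(1) assms(3) by blast
qed

end

section \<open>Decomposing a tree\<close>

lemma simple_graph_edgeE:
  assumes "simple_graph G" "e \<in> edges G"
  obtains u v where "u \<in> verts G" "v \<in> verts G" "u \<noteq> v" "e = {u, v}"
  using assms unfolding simple_graph_def by blast

lemma simple_graph_edge_verts:
  assumes "simple_graph G" "e \<in> edges G" "v \<in> e"
  shows "v \<in> verts G"
  by (rule simple_graph_edgeE[OF assms(1,2)]) (use assms(3) in auto)

text \<open>The components are the reachability classes \<open>comp v\<close> with all edges inside
  them. Vertices of one class give the same graph \<open>S v\<close>, so the image of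
  \<open>S\<close> contains each component once.\<close>

lemma graph_components:
  assumes H: "simple_graph H"
  obtains \<T> where "finite \<T>" "H = graph_union \<T>"
    "\<And>S S'. S \<in> \<T> \<Longrightarrow> S' \<in> \<T> \<Longrightarrow> S \<noteq> S' \<Longrightarrow> verts S \<inter> verts S' = {}"
    "\<And>S. S \<in> \<T> \<Longrightarrow> subgraph S H \<and> verts S \<noteq> {} \<and> graph_connected S"
proof -
  define R where "R = {(x, y). {x, y} \<in> edges H}"
  have "sym R" by (auto simp: R_def sym_def insert_commute)
  then have symR: "sym (R\<^sup>*)" by (rule sym_rtrancl)
  define comp where "comp v = {u. (v, u) \<in> R\<^sup>*}" for v
  define S where "S v = (comp v, {e \<in> edges H. e \<subseteq> comp v})" for v
  have comp_verts: "comp v \<subseteq> verts H" if "v \<in> verts H" for v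
  proof
    fix u assume "u \<in> comp v"
    then have "(v, u) \<in> R\<^sup>*" by (simp add: comp_def)
    then show "u \<in> verts H" using that
      by (induction rule: rtrancl_induct) (auto simp: R_def dest: simple_graph_edgeD[OF H])
  qed
  have comp_eq: "comp u = comp v" if "u \<in> comp v" for u v
    using that symR unfolding comp_def by (auto dest: symD intro: rtrancl_trans)
  have edge_comp: "{x, y} \<subseteq> comp x" if "{x, y} \<in> edges H" for x y
    using that by (auto simp: comp_def R_def)
  have conn: "graph_connected (S v)" for v
    unfolding graph_connected_def
  proof (intro ballI)
    fix x y assume "x \<in> verts (S v)" "y \<in> verts (S v)"
    then have x: "comp x = comp v" and y: "y \<in> comp v" using comp_eq by (auto simp: S_def)
    have "(x, y) \<in> R\<^sup>*" using x y by (auto simp: comp_def)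
    then show "(x, y) \<in> {(x, y). {x, y} \<in> edges (S v)}\<^sup>*"
    proof (induction rule: rtrancl_induct)
      case (step y z)
      have "{y, z} \<in> edges H" using step by (simp add: R_def)
      moreover have "comp y = comp v" using step.hyps(1) comp_eq[of y x] x by (simp add: comp_def)
      ultimately have "{y, z} \<in> edges (S v)" using edge_comp[of y z] by (simp add: S_def)
      then show ?case using step.IH by (simp add: rtrancl_into_rtrancl)
    qed simp
  qed
  show ?thesis
  proof (rule that[of "S ` verts H"])
    show "finite (S ` verts H)" using H by (simp add: simple_graph_def)
    have "verts H = (\<Union>v\<in>verts H. comp v)"
      using comp_verts by (auto simp: comp_def)
    moreover have "edges H = (\<Union>v\<in>verts H. {e \<in> edges H. e \<subseteq> comp v})"
    proof
      show "edges H \<subseteq> (\<Union>v\<in>verts H. {e \<in> edges H. e \<subseteq> comp v})"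
      proof
        fix e assume e: "e \<in> edges H"
        then obtain x y where "x \<in> verts H" "e = {x, y}" by (elim simple_graph_edgeE[OF H])
        then show "e \<in> (\<Union>v\<in>verts H. {e \<in> edges H. e \<subseteq> comp v})" using e edge_comp[of x y] by blast
      qed
    qed auto
    ultimately show "H = graph_union (S ` verts H)"
      by (simp add: graph_union_def S_def image_image prod_eq_iff)
  next
    fix X Y assume "X \<in> S ` verts H" "Y \<in> S ` verts H" "X \<noteq> Y"
    then obtain x y where "X = S x" "Y = S y" "comp x \<noteq> comp y" by (auto simp: S_def)
    moreover have "comp x = comp y" if "u \<in> comp x" "u \<in> comp y" for u
      using comp_eq[OF that(1)] comp_eq[OF that(2)] by simp
    ultimately show "verts X \<inter> verts Y = {}" by (auto simp: S_def)
  next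
    fix X assume "X \<in> S ` verts H"
    then obtain v where v: "v \<in> verts H" "X = S v" by blast
    have "finite (comp v)" using comp_verts[OF v(1)] H by (auto simp: simple_graph_def intro: finite_subset)
    moreover have "\<exists>x\<in>comp v. \<exists>y\<in>comp v. x \<noteq> y \<and> e = {x, y}" if e: "e \<in> edges H" "e \<subseteq> comp v" for e
    proof -
      obtain x y where "x \<noteq> y" "e = {x, y}" by (rule simple_graph_edgeE[OF H e(1)])
      then show ?thesis using e(2) by blast
    qed
    ultimately have "simple_graph X" unfolding simple_graph_def v(2) S_def by auto
    moreover have "v \<in> verts X" using v by (simp add: S_def comp_def)
    ultimately show "subgraph X H \<and> verts X \<noteq> {} \<and> graph_connected X"
      using conn comp_verts[OF v(1)] v by (auto simp: subgraph_def S_def)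
  qed
qed

lemma subgraph_tree:
  assumes "tree T" "subgraph S T" "verts S \<noteq> {}" "graph_connected S"
  shows "tree S"
proof -
  have "graph_cycle T c" if "graph_cycle S c" for c
    using that assms(2) by (auto simp: graph_cycle_def subgraph_def)
  then show ?thesis using assms by (auto simp: tree_def subgraph_def)
qed

section \<open>Closest pairs of boxes and the forests of a numbering\<close>

context box_model
begin

lemma box_nonempty: "C \<in> boxes \<Longrightarrow> C \<noteq> {}"
proof -
  have "cbox a (a + s) \<noteq> {}" for a using s_nonneg by (auto simp: box_ne_empty inner_simps)
  then show "C \<in> boxes \<Longrightarrow> C \<noteq> {}" by (auto simp: boxes_def)
qed

text \<open>The weight \<open>w\<close> is a lower bound for the distance of pairs realising an
  edge, and the selected boxes \<open>X\<close> attain it on the edges of \<open>S\<close>.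
  Sightings between selected boxes survive the removal of the others. A new sighting comes from a
  geodesic chain, whose owners walk in \<open>T\<close>; minimality forces this walk to be the path
  in \<open>S\<close>, and injective heights force the second box of the chain to be a selected
  one.\<close>

lemma minimal_transversal_visibility_tree:
  fixes T :: "'v graph" and f :: "'v \<Rightarrow> 'a set set" and w :: "'v \<Rightarrow> 'v \<Rightarrow> real"
  defines "\<C> \<equiv> \<Union>(f ` verts T)"
  assumes T: "tree T" and rep: "visibility_rep boxes D T f"
    and metric: "sight_metric \<C> \<delta>"
    and w_pos: "\<And>u v. {u, v} \<in> edges T \<Longrightarrow> w u v > 0"
    and w_le: "\<And>u v A B. {u, v} \<in> edges T \<Longrightarrow> A \<in> f u \<Longrightarrow> B \<in> f v \<Longrightarrow> sees D \<C> A B \<Longrightarrow> w u v \<le> \<delta> A B"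
    and S: "subgraph S T" "verts S \<noteq> {}" "graph_connected S"
    and X: "\<And>v. v \<in> verts S \<Longrightarrow> X v \<in> f v"
    and w_eq: "\<And>u v. {u, v} \<in> edges S \<Longrightarrow> sees D \<C> (X u) (X v) \<and> \<delta> (X u) (X v) = w u v"
  shows "visibility_tree boxes D S"
proof -
  have Tsimple: "simple_graph T" and Tacyc: "\<nexists>c. graph_cycle T c" using T by (auto simp: tree_def)
  have Ssimple: "simple_graph S" and ST: "verts S \<subseteq> verts T" "edges S \<subseteq> edges T"
    using S by (auto simp: subgraph_def)
  note repD = visibility_repD[OF rep, folded \<C>_def]
  define \<X> where "\<X> = X ` verts S"
  have XT: "X v \<in> \<C>" if "v \<in> verts S" for v using X[OF that] that ST by (auto simp: \<C>_def)
  then have XC: "\<X> \<subseteq> \<C>" by (auto simp: \<X>_def)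
  have Xneq: "X u \<noteq> X v" if "u \<in> verts S" "v \<in> verts S" "u \<noteq> v" for u v
  proof -
    have "X u \<inter> X v = {}" using repD(4)[of u v "X u" "X v"] that ST X by auto
    moreover have "X u \<noteq> {}" using repD(1)[of u] box_nonempty X that ST by blast
    ultimately show ?thesis by auto
  qed
  \<comment> \<open>Boxes of different vertices are disjoint and boxes are nonempty, so for members
    of \<open>\<C>\<close> there is only one possible choice.\<close>
  define own where "own C = (SOME v. v \<in> verts T \<and> C \<in> f v)" for C
  have own: "own C \<in> verts T" "C \<in> f (own C)" if "C \<in> \<C>" for C
    using someI_ex[of "\<lambda>v. v \<in> verts T \<and> C \<in> f v"] that unfolding own_def \<C>_def by auto
  have own_X: "own (X v) = v" if "v \<in> verts S" for v
  proof (rule ccontr)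
    assume "own (X v) \<noteq> v"
    then have "X v \<inter> X v = {}" using repD(4)[of "own (X v)" v "X v" "X v"] own XT X that ST by auto
    then show False using repD(1)[of v] box_nonempty X that ST by blast
  qed
  have own_edge: "{own P, own Q} \<in> edges T" if "P \<in> \<C>" "Q \<in> \<C>" "P \<noteq> Q" "sees D \<C> P Q" for P Q
  proof -
    have "own P \<noteq> own Q" using repD(6)[of "own P" P Q] own that by auto
    then show ?thesis using repD(5)[of "own P" "own Q"] own that by blast
  qed
  have edge_of_chain: "{a, b} \<in> edges S"
    if ab: "a \<in> verts S" "b \<in> verts S" and h: "inj_on h \<C>" "\<forall>P\<in>\<C>. \<forall>Q\<in>\<C>. \<bar>h P - h Q\<bar> \<le> \<delta> P Q"
      and cs: "length cs \<ge> 2" "hd cs = X a" "last cs = X b" "set cs \<subseteq> \<C>" "set cs \<inter> \<X> \<subseteq> {X a, X b}" "distinct cs"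
        "successively (\<lambda>P Q. P \<noteq> Q \<and> sees D \<C> P Q \<and> \<delta> P Q = h Q - h P) cs"
    for a b cs and h :: "'a set \<Rightarrow> real"
  proof -
    \<comment> \<open>Each step of the chain rises by the distance of two boxes that see each other,
      which is at least the weight of the edge between their owners.\<close>
    have upper: "walk_weight w (map own ds) \<le> h (last ds) - h (hd ds)"
      if "ds \<noteq> []" "set ds \<subseteq> \<C>" "successively (\<lambda>P Q. P \<noteq> Q \<and> sees D \<C> P Q \<and> \<delta> P Q = h Q - h P) ds" for ds
    proof -
      have "walk_weight w (map own ds) \<le> walk_weight (\<lambda>P Q. h Q - h P) ds"
        unfolding walk_weight_map
      proof (rule walk_weight_mono, rule successively_mono[OF that(3)])
        fix P Q assume "P \<in> set ds" "Q \<in> set ds" and *: "P \<noteq> Q \<and> sees D \<C> P Q \<and> \<delta> P Q = h Q - h P"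
        then have PQ: "P \<in> \<C>" "Q \<in> \<C>" using that by auto
        then show "w (own P) (own Q) \<le> h Q - h P"
          using w_le[OF own_edge[OF PQ] own(2)[OF PQ(1)] own(2)[OF PQ(2)]] * by simp
      qed
      then show ?thesis using walk_weight_telescope[OF that(1), of h] by simp
    qed
    \<comment> \<open>Along edges of \<open>S\<close> the weight is the distance of the selected
      boxes, and \<open>h\<close> is 1-Lipschitz.\<close>
    have lower: "h (X (last p)) - h (X (hd p)) \<le> walk_weight w p" if "walk S p" "p \<noteq> []" for p
    proof -
      have "walk_weight (\<lambda>u v. h (X v) - h (X u)) p \<le> walk_weight w p"
      proof (rule walk_weight_mono, rule successively_mono[OF that(1)])
        fix u v assume e: "{u, v} \<in> edges S"
        then have "X u \<in> \<C>" "X v \<in> \<C>" using simple_graph_edgeD[OF Ssimple] XT by blast+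
        then have "\<bar>h (X u) - h (X v)\<bar> \<le> \<delta> (X u) (X v)" using h(2) by blast
        then show "h (X v) - h (X u) \<le> w u v" using w_eq[OF e] by simp
      qed
      then show ?thesis using walk_weight_telescope[OF that(2), of "\<lambda>v. h (X v)"] by simp
    qed
    have "cs \<noteq> []" using cs(1) by auto
    have walk_cs: "walk T (map own cs)"
      unfolding successively_map
      by (rule successively_mono[OF cs(7)]) (use own_edge cs(4) in blast)
    obtain p where p: "walk S p" "distinct p" "p \<noteq> []" "hd p = a" "last p = b"
      using rtrancl_imp_path S(3) ab unfolding graph_connected_def by metis
    have "walk T p" by (rule successively_mono[OF p(1)]) (use ST in blast)
    \<comment> \<open>The owners of the chain walk from \<open>a\<close> to \<open>b\<close>, just
      as the path \<open>p\<close> does. By \<open>upper\<close> and \<open>lower\<close> the walk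
      is no heavier than the path, which leaves only equality.\<close>
    then have "p = map own cs \<or> walk_weight w p < walk_weight w (map own cs)"
      using walk_path_less[OF Tsimple Tacyc w_pos walk_cs] \<open>cs \<noteq> []\<close> p cs own_X ab
      by (simp add: hd_map last_map)
    moreover have "walk_weight w (map own cs) \<le> walk_weight w p"
      using upper[OF \<open>cs \<noteq> []\<close> cs(4,7)] lower[OF p(1,3)] cs p by simp
    ultimately have p_eq: "p = map own cs" by auto
    obtain C1 ds where cs_eq: "cs = X a # C1 # ds"
      using cs(1,2) by (cases cs; cases "tl cs") auto
    define c1 where "c1 = own C1"
    have p_eq': "p = a # c1 # map own ds" using p_eq cs_eq own_X ab by (simp add: c1_def)
    have ac1: "{a, c1} \<in> edges S" using p(1) p_eq' by simp
    then have c1: "c1 \<in> verts S" using simple_graph_edgeD[OF Ssimple] by blast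
    have C1: "C1 \<in> \<C>" "sees D \<C> (X a) C1" "\<delta> (X a) C1 = h C1 - h (X a)" using cs cs_eq by auto
    \<comment> \<open>First comparison: since \<open>X a\<close> and \<open>X c1\<close> realise
      their edge at minimal distance, \<open>X c1\<close> is not higher than the second box
      \<open>C1\<close> of the chain.\<close>
    have "\<bar>h (X a) - h (X c1)\<bar> \<le> \<delta> (X a) (X c1)" using h(2) XT ab(1) c1 by blast
    also have "\<dots> = w a c1" using w_eq[OF ac1] by simp
    also have "\<dots> \<le> \<delta> (X a) C1"
      using w_le[of a c1 "X a" C1] ac1 ST own(2)[OF C1(1)] X ab(1) C1(2) by (auto simp: c1_def)
    finally have "h (X c1) \<le> h C1" using C1(3) by simp
    \<comment> \<open>Second comparison: the bounds \<open>upper\<close> and \<open>lower\<close>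
      for the remaining part of the chain and of the path give the opposite inequality.\<close>
    moreover have "h (X (last p)) - h (X c1) \<le> h (last cs) - h C1"
      using upper[of "C1 # ds"] lower[of "c1 # map own ds"] p cs unfolding p_eq' cs_eq
      by (simp add: c1_def)
    ultimately have "h (X c1) = h C1" using p(5) cs(3) by simp
    \<comment> \<open>Equal heights mean equal boxes. Thus \<open>C1\<close> was kept, but among the
      boxes of the chain only the two ends can be kept, so \<open>C1\<close> is the far end and
      \<open>a\<close>, \<open>b\<close> are adjacent.\<close>
    then have "X c1 = C1" using inj_onD[OF h(1)] XT c1 C1(1) by blast
    then have "C1 \<in> set cs \<inter> \<X>" using c1 cs_eq by (auto simp: \<X>_def)
    then have "C1 = X b" using cs(5,6) cs_eq by auto
    then have "c1 = b" using own_X ab by (simp add: c1_def)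
    then show ?thesis using ac1 by simp
  qed
  have edge_iff: "{u, v} \<in> edges S \<longleftrightarrow> sees D \<X> (X u) (X v)"
    if uv: "u \<in> verts S" "v \<in> verts S" "u \<noteq> v" for u v
  proof
    assume "{u, v} \<in> edges S"
    then show "sees D \<X> (X u) (X v)" using w_eq sees_mono XC by blast
  next
    assume "sees D \<X> (X u) (X v)"
    moreover have "X u \<in> \<X>" "X v \<in> \<X>" using uv by (auto simp: \<X>_def)
    ultimately have "\<exists>h cs. sight_chain \<C> \<delta> \<X> (X u) (X v) h cs"
      using sight_metricD(3)[OF metric XC] Xneq[OF uv] by simp
    then obtain h cs where h: "inj_on h \<C>" "\<forall>P\<in>\<C>. \<forall>Q\<in>\<C>. \<bar>h P - h Q\<bar> \<le> \<delta> P Q"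
      and cs: "length cs \<ge> 2" "hd cs = X u \<and> last cs = X v \<or> hd cs = X v \<and> last cs = X u"
        "set cs \<subseteq> \<C>" "set cs \<inter> \<X> \<subseteq> {X u, X v}" "distinct cs"
        "successively (\<lambda>P Q. P \<noteq> Q \<and> sees D \<C> P Q \<and> \<delta> P Q = h Q - h P) cs"
      unfolding sight_chain_def by (elim exE conjE)
    from cs(2) show "{u, v} \<in> edges S"
    proof
      assume "hd cs = X u \<and> last cs = X v"
      then show ?thesis using edge_of_chain[OF uv(1,2) h cs(1)] cs(3-) by blast
    next
      assume "hd cs = X v \<and> last cs = X u"
      moreover have "set cs \<inter> \<X> \<subseteq> {X v, X u}" using cs(4) by blast
      ultimately have "{v, u} \<in> edges S" using edge_of_chain[OF uv(2,1) h cs(1)] cs(3,5,6) by blast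
      then show ?thesis by (simp add: insert_commute)
    qed
  qed
  have \<X>: "\<Union>((\<lambda>v. {X v}) ` verts S) = \<X>" by (auto simp: \<X>_def)
  have "visibility_rep boxes D S (\<lambda>v. {X v})"
    unfolding visibility_rep_def \<X>
  proof (intro conjI ballI impI)
    fix v assume "v \<in> verts S"
    then show "{X v} \<subseteq> boxes" using repD(1)[of v] X ST by blast
  next
    fix u v A B assume "u \<in> verts S" "v \<in> verts S" "A \<in> {X u}" "B \<in> {X v}" "(u, A) \<noteq> (v, B)"
    then show "A \<inter> B = {}" using repD(4)[of u v A B] X ST by blast
  qed (use edge_iff in auto)
  then have "visibility_graph boxes D S" using Ssimple unfolding visibility_graph_def by auto
  then show ?thesis using subgraph_tree[OF T S] by (simp add: visibility_tree_def)
qed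

text \<open>The bound of the arboricity by the visibility number. The \<open>t\<close> forests are
  the classes of a numbering of the boxes, each edge being counted in the class of the closest pair
  chosen for it.\<close>

lemma rep_imp_forests:
  fixes T :: "'v graph"
  assumes T: "tree T" and rep: "visibility_rep boxes D T f"
    and t: "\<And>v. v \<in> verts T \<Longrightarrow> card (f v) \<le> t"
  obtains H :: "nat \<Rightarrow> 'v graph" where
    "\<And>j. j < t \<Longrightarrow> subgraph (H j) T \<and> visibility_forest boxes D (H j)" "T = graph_union (H ` {..<t})"
proof -
  have Tsimple: "simple_graph T" using T by (auto simp: tree_def)
  define \<C> where "\<C> = \<Union>(f ` verts T)"
  note repD = visibility_repD[OF rep, folded \<C>_def]
  have "finite \<C>" using repD(2) Tsimple by (auto simp: \<C>_def simple_graph_def)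
  moreover have "\<C> \<subseteq> boxes" using repD(1) by (auto simp: \<C>_def)
  moreover have "P \<inter> Q = {}" if PQ: "P \<in> \<C>" "Q \<in> \<C>" "P \<noteq> Q" for P Q
  proof -
    obtain u v where "u \<in> verts T" "v \<in> verts T" "P \<in> f u" "Q \<in> f v" using PQ unfolding \<C>_def by blast
    then show ?thesis using repD(4)[of u v P Q] PQ(3) by blast
  qed
  ultimately have "\<exists>\<delta>. sight_metric \<C> \<delta>" by (rule sight_metric_exists)
  then obtain \<delta> where metric: "sight_metric \<C> \<delta>" ..
  note \<delta> = sight_metricD[OF metric]

  \<comment> \<open>For an edge \<open>e\<close>, \<open>x v\<close> is the box of \<open>v\<close>
    in a closest pair realising \<open>e\<close>; such a pair exists because there are finitely many
    candidates, and at least one.\<close>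
  have "\<exists>x. (\<forall>v\<in>e. x v \<in> f v) \<and> (\<forall>u\<in>e. \<forall>v\<in>e. u \<noteq> v \<longrightarrow> sees D \<C> (x u) (x v) \<and>
      (\<forall>A\<in>f u. \<forall>B\<in>f v. sees D \<C> A B \<longrightarrow> \<delta> (x u) (x v) \<le> \<delta> A B))" if e: "e \<in> edges T" for e
  proof -
    obtain a b where ab: "e = {a, b}" "a \<noteq> b" "a \<in> verts T" "b \<in> verts T"
      by (rule simple_graph_edgeE[OF Tsimple e])
    define M where "M = {(A, B). A \<in> f a \<and> B \<in> f b \<and> sees D \<C> A B}"
    have "M \<subseteq> f a \<times> f b" by (auto simp: M_def)
    then have "finite M" using repD(2) ab(3,4) by (meson finite_SigmaI finite_subset)
    moreover have "M \<noteq> {}" using repD(5)[OF ab(3,4,2)] e ab(1) by (auto simp: M_def)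
    ultimately obtain z where "is_arg_min (case_prod \<delta>) (\<lambda>z. z \<in> M) z"
      using ex_is_arg_min_if_finite by blast
    then obtain A B where AB: "(A, B) \<in> M" and min: "\<And>A' B'. (A', B') \<in> M \<Longrightarrow> \<delta> A B \<le> \<delta> A' B'"
      by (cases z) (auto simp: is_arg_min_linorder)
    have min': "\<delta> B A \<le> \<delta> B' A'" if "A' \<in> f a" "B' \<in> f b" "sees D \<C> B' A'" for A' B'
      using min[of A' B'] that sees_sym[OF that(3)] \<delta>(1)[of A B] \<delta>(1)[of A' B'] by (simp add: M_def)
    show ?thesis
      using AB min min' ab(1,2) sees_sym[of D \<C> A B]
      by (intro exI[of _ "\<lambda>v. if v = a then A else B"]) (auto simp: M_def)
  qed
  then obtain x where x_mem: "\<And>e v. e \<in> edges T \<Longrightarrow> v \<in> e \<Longrightarrow> x e v \<in> f v"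
    and x_min: "\<And>e u v. e \<in> edges T \<Longrightarrow> u \<in> e \<Longrightarrow> v \<in> e \<Longrightarrow> u \<noteq> v \<Longrightarrow> sees D \<C> (x e u) (x e v) \<and>
      (\<forall>A\<in>f u. \<forall>B\<in>f v. sees D \<C> A B \<longrightarrow> \<delta> (x e u) (x e v) \<le> \<delta> A B)"
    by metis

  \<comment> \<open>Different boxes of a vertex get different numbers below \<open>t\<close>, and
    the two boxes chosen for an edge get the same number.\<close>
  define good where "good W num \<longleftrightarrow> (\<forall>v\<in>W. inj_on (num v) (f v) \<and> num v ` f v \<subseteq> {..<t}) \<and>
    (\<forall>e\<in>edges T. e \<subseteq> W \<longrightarrow> (\<forall>u\<in>e. \<forall>v\<in>e. num u (x e u) = num v (x e v)))"
    for W and num :: "'v \<Rightarrow> 'a set \<Rightarrow> nat"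
  have "\<exists>num. good (verts T) num"
    using T
  proof (rule tree_vertex_induct)
    fix r assume r: "r \<in> verts T"
    obtain A where A: "A \<in> f r" using repD(3)[OF r] by blast
    then have "card (f r) > 0" using repD(2)[OF r] by (auto simp: card_gt_0_iff)
    then have "0 < t" using t[OF r] by simp
    obtain g where "inj_on g (f r)" "g ` f r \<subseteq> {..<t}"
      using inj_on_extend_point[OF repD(2)[OF r] t[OF r] A \<open>0 < t\<close>] by blast
    moreover have "\<not> e \<subseteq> {r}" if "e \<in> edges T" for e
      by (rule simple_graph_edgeE[OF Tsimple that]) auto
    ultimately show "\<exists>num. good {r} num" by (intro exI[of _ "\<lambda>_. g"]) (simp add: good_def)
  next
    fix W v w assume W: "W \<subseteq> verts T" "\<exists>num. good W num" "w \<in> W" "v \<in> verts T - W" "{v, w} \<in> edges T"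
      and uniq: "\<And>w'. w' \<in> W \<Longrightarrow> {v, w'} \<in> edges T \<Longrightarrow> w' = w"
    let ?e = "{v, w}"
    obtain num where num: "good W num" using W by blast
    then have num_W: "inj_on (num u) (f u) \<and> num u ` f u \<subseteq> {..<t}" if "u \<in> W" for u
      using that unfolding good_def by blast
    have "num w (x ?e w) < t" using num W(3) x_mem[OF W(5)] by (auto simp: good_def)
    then have "\<exists>g. inj_on g (f v) \<and> g ` f v \<subseteq> {..<t} \<and> g (x ?e v) = num w (x ?e w)"
      using repD(2) t W(4) x_mem[OF W(5)] by (intro inj_on_extend_point) auto
    then obtain g where g: "inj_on g (f v)" "g ` f v \<subseteq> {..<t}" "g (x ?e v) = num w (x ?e w)"
      by (elim exE conjE)
    \<comment> \<open>The edge to \<open>w\<close> is the only new one, so the numbering at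
      \<open>v\<close> has a single prescribed value.\<close>
    have edge_cases: "e \<subseteq> W \<or> e = ?e" if e: "e \<in> edges T" "e \<subseteq> insert v W" for e
    proof (cases "v \<in> e")
      case True
      obtain a b where ab: "a \<noteq> b" "e = {a, b}"
        by (rule simple_graph_edgeE[OF Tsimple e(1)])
      obtain w' where w': "e = {v, w'}" "w' \<noteq> v"
      proof (cases "v = a")
        case False
        then have "v = b" using True ab by simp
        then show ?thesis using ab by (intro that[of a]) auto
      qed (use ab that in auto)
      then have "w' \<in> W" using e(2) w' by blast
      then show ?thesis using uniq[of w'] w' e(1) by simp
    qed (use e in blast)
    have "good (insert v W) (num(v := g))"
      unfolding good_def
    proof (intro conjI ballI impI)
      fix u assume "u \<in> insert v W"
      then show "inj_on ((num(v := g)) u) (f u)" "(num(v := g)) u ` f u \<subseteq> {..<t}"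
        using g(1,2) num_W[of u] by (cases "u = v"; simp)+
    next
      fix e u u' assume e: "e \<in> edges T" "e \<subseteq> insert v W" "u \<in> e" "u' \<in> e"
      from edge_cases[OF e(1,2)] show "(num(v := g)) u (x e u) = (num(v := g)) u' (x e u')"
      proof
        assume eW: "e \<subseteq> W"
        then have "num u (x e u) = num u' (x e u')" using num e unfolding good_def by blast
        moreover have "u \<noteq> v" "u' \<noteq> v" using eW e W(4) by auto
        ultimately show ?thesis by simp
      next
        assume "e = ?e"
        then show ?thesis using g(3) e W by auto
      qed
    qed
    then show "\<exists>num. good (insert v W) num" by blast
  qed
  then obtain num where num: "good (verts T) num" ..
  note num_verts = conjunct1[OF num[unfolded good_def]] and num_edges = conjunct2[OF num[unfolded good_def]]
  have num_inj: "inj_on (num v) (f v)" if "v \<in> verts T" for v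
    using num_verts that by blast
  have num_less: "num v A < t" if "v \<in> verts T" "A \<in> f v" for v A
    using num_verts that by (meson image_subset_iff lessThan_iff)
  have num_eq: "num u (x e u) = num v (x e v)" if "e \<in> edges T" "e \<subseteq> verts T" "u \<in> e" "v \<in> e" for e u v
    using num_edges that by blast
  have edge_verts: "e \<subseteq> verts T" if "e \<in> edges T" for e
    using simple_graph_edge_verts[OF Tsimple that] by blast

  \<comment> \<open>A vertex belongs to \<open>H j\<close> as soon as one of its boxes has number
    \<open>j\<close>, even if no edge of this class meets it. This way a tree with one vertex is
    covered as well.\<close>
  define H where "H j = ({v \<in> verts T. \<exists>A\<in>f v. num v A = j}, {e \<in> edges T. \<forall>u\<in>e. num u (x e u) = j})" for j
  have H_sub: "subgraph (H j) T" for j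
  proof -
    have "\<exists>u\<in>verts (H j). \<exists>v\<in>verts (H j). u \<noteq> v \<and> e = {u, v}" if "e \<in> edges (H j)" for e
    proof -
      have e: "e \<in> edges T" "\<forall>u\<in>e. num u (x e u) = j" using that by (auto simp: H_def)
      obtain u v where uv: "u \<in> verts T" "v \<in> verts T" "u \<noteq> v" "e = {u, v}"
        by (rule simple_graph_edgeE[OF Tsimple e(1)])
      then have "u \<in> verts (H j)" "v \<in> verts (H j)" using e x_mem[OF e(1)] by (auto simp: H_def)
      then show ?thesis using uv by blast
    qed
    moreover have "finite (verts (H j))" using Tsimple by (simp add: H_def simple_graph_def)
    ultimately show ?thesis unfolding subgraph_def simple_graph_def by (auto simp: H_def)
  qed
  have H_tree: "visibility_tree boxes D S"
    if S: "subgraph S (H j)" "verts S \<noteq> {}" "graph_connected S" for S j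
  proof -
    have ST: "subgraph S T" using S(1) H_sub[of j] by (auto simp: subgraph_def)
    define X where "X v = (SOME A. A \<in> f v \<and> num v A = j)" for v
    have X: "X v \<in> f v \<and> num v (X v) = j" if "v \<in> verts S" for v
    proof -
      have "\<exists>A. A \<in> f v \<and> num v A = j" using that S(1) by (auto simp: subgraph_def H_def)
      then show ?thesis unfolding X_def by (rule someI_ex)
    qed
    \<comment> \<open>The number determines the box at a vertex, so all edges of the class at
      \<open>v\<close> use the same box. This is what permits one box per vertex.\<close>
    have X_eq: "X v = x e v" if "e \<in> edges S" "v \<in> e" for e v
    proof -
      have e: "e \<in> edges T" "num v (x e v) = j" using that S(1) by (auto simp: subgraph_def H_def)
      have "v \<in> verts S" using simple_graph_edge_verts[of S e v] that ST by (simp add: subgraph_def)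
      moreover have "v \<in> verts T" using edge_verts[OF e(1)] that by blast
      ultimately show ?thesis using inj_onD[OF num_inj] X x_mem[OF e(1) that(2)] e(2) by simp
    qed
    define w where "w u v = \<delta> (x {u, v} u) (x {u, v} v)" for u v
    show ?thesis
    proof (rule minimal_transversal_visibility_tree[where f = f and \<delta> = \<delta> and w = w and X = X and T = T, folded \<C>_def])
      show "tree T" "visibility_rep boxes D T f" using T rep .
      show "subgraph S T" "verts S \<noteq> {}" "graph_connected S" using ST S(2,3) .
      show "X v \<in> f v" if "v \<in> verts S" for v using X[OF that] by simp
    next
      fix u v A B assume "{u, v} \<in> edges T" "A \<in> f u" "B \<in> f v" "sees D \<C> A B"
      then show "w u v \<le> \<delta> A B"
        using x_min[of "{u, v}" u v] simple_graph_edgeD[OF Tsimple] unfolding w_def by blast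
    next
      fix u v assume e: "{u, v} \<in> edges T"
      then have uv: "u \<noteq> v" "u \<in> verts T" "v \<in> verts T" using simple_graph_edgeD[OF Tsimple] by blast+
      have mem: "x {u, v} u \<in> f u" "x {u, v} v \<in> f v" using x_mem[OF e] by blast+
      have "x {u, v} u \<inter> x {u, v} v = {}" using repD(4)[OF uv(2,3) mem] uv(1) by blast
      then have "x {u, v} u \<noteq> x {u, v} v" using repD(1)[OF uv(2)] mem box_nonempty by blast
      \<comment> \<open>The sighting that realises the edge has some direction.\<close>
      moreover have "D \<noteq> {}" using x_min[OF e, of u v] uv(1) by (auto simp: sees_def)
      ultimately show "w u v > 0" unfolding w_def using \<delta>(2) mem uv by (auto simp: \<C>_def)
    next
      fix u v assume e: "{u, v} \<in> edges S"
      have "u \<noteq> v" using simple_graph_edgeD[of S u v] e ST by (simp add: subgraph_def)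
      moreover have "{u, v} \<in> edges T" using e ST by (auto simp: subgraph_def)
      ultimately show "sees D \<C> (X u) (X v) \<and> \<delta> (X u) (X v) = w u v"
        using x_min[of "{u, v}" u v] X_eq[OF e] by (simp add: w_def)
    qed (rule metric)
  qed
  have "visibility_forest boxes D (H j)" for j
  proof -
    have "simple_graph (H j)" using H_sub by (simp add: subgraph_def)
    then obtain \<T> where "finite \<T>" "H j = graph_union \<T>"
      "\<And>S S'. S \<in> \<T> \<Longrightarrow> S' \<in> \<T> \<Longrightarrow> S \<noteq> S' \<Longrightarrow> verts S \<inter> verts S' = {}"
      "\<And>S. S \<in> \<T> \<Longrightarrow> subgraph S (H j) \<and> verts S \<noteq> {} \<and> graph_connected S"
      by (rule graph_components) (assumption | rule that)+
    then show ?thesis unfolding visibility_forest_def using H_tree[of _ j]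
      by (intro exI[of _ \<T>] conjI ballI impI) simp_all
  qed
  moreover have "T = graph_union (H ` {..<t})"
  proof (rule prod_eqI)
    show "verts T = verts (graph_union (H ` {..<t}))"
      using num_less repD(3) by (fastforce simp: graph_union_def H_def)
    have "e \<in> (\<Union>j<t. edges (H j))" if e: "e \<in> edges T" for e
    proof -
      obtain u where u: "u \<in> e" "u \<in> verts T" by (rule simple_graph_edgeE[OF Tsimple e]) auto
      have "num u (x e u) < t" using num_less u x_mem[OF e] by blast
      moreover have "e \<in> edges (H (num u (x e u)))"
        unfolding H_def using e num_eq[OF e edge_verts[OF e] _ u(1)] by simp
      ultimately show ?thesis by blast
    qed
    then show "edges T = edges (graph_union (H ` {..<t}))"
      by (auto simp: graph_union_def H_def)
  qed
  ultimately show ?thesis using that[of H] H_sub by blast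
qed

text \<open>For every \<open>k\<close>, a decomposition into \<open>k\<close> forests exists exactly
  if a representation with at most \<open>k\<close> boxes per vertex does. Hence both infima are
  taken over the same set, which may be empty.\<close>

theorem tree_arboricity_eq_visibility_number:
  fixes T :: "'v graph"
  assumes T: "tree T"
  shows "visibility_arboricity boxes D T = visibility_number boxes D T"
proof -
  have "(\<exists>F :: nat \<Rightarrow> 'v graph. (\<forall>j<k. subgraph (F j) T \<and> visibility_forest boxes D (F j)) \<and>
      T = graph_union (F ` {..<k})) \<longleftrightarrow>
    (\<exists>f. visibility_rep boxes D T f \<and> (\<forall>v\<in>verts T. card (f v) \<le> k))" (is "?L \<longleftrightarrow> ?R") for k
  proof
    assume ?L
    then show ?R using forests_imp_rep[of k _ T] by blast
  next
    assume ?R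
    then obtain f where f: "visibility_rep boxes D T f" "\<And>v. v \<in> verts T \<Longrightarrow> card (f v) \<le> k" by blast
    show ?L by (rule rep_imp_forests[OF T f]) blast+
  qed
  then show ?thesis unfolding visibility_arboricity_def visibility_number_def by simp
qed

end

theorem theorem2:
  fixes T :: "'v graph"
  assumes "tree T"
  shows "cube_arboricity TYPE('n::finite) T = cube_visibility_number TYPE('n) T \<and>
         cube_orthogonal_arboricity TYPE('n) T = cube_orthogonal_visibility_number TYPE('n) T"
proof
  interpret cube: box_model "One :: real ^ 'n" Basis
    by unfold_locales (auto simp: inner_Basis)
  have "cube.boxes = unit_cubes" by (simp add: cube.boxes_def unit_cubes_def)
  then show "cube_arboricity TYPE('n) T = cube_visibility_number TYPE('n) T"
    using cube.tree_arboricity_eq_visibility_number[OF assms]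
    by (simp add: cube_arboricity_def cube_visibility_number_def)
  interpret plate: box_model "(One, 0) :: (real ^ 'n) \<times> real" "{(0, 1)}"
    by unfold_locales (auto simp: Basis_prod_def inner_Basis)
  \<comment> \<open>A box in the product is a product of boxes; the zero side shrinks the last
    factor to a single point.\<close>
  have "plate.boxes = orthogonal_unit_cubes"
    unfolding plate.boxes_def orthogonal_unit_cubes_def
    by (auto simp: cbox_Pair_eq)
  then show "cube_orthogonal_arboricity TYPE('n) T = cube_orthogonal_visibility_number TYPE('n) T"
    using plate.tree_arboricity_eq_visibility_number[OF assms]
    by (simp add: cube_orthogonal_arboricity_def cube_orthogonal_visibility_number_def)
qed

end
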